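(* Let $p$ be a prime and let $A$ be a multiplicative subgroup of $\mathbb{F}_p^*$ with $|A|\le p^{1/2}\log p$. Then \[|[A,A,0][A,A,0]|\gtrsim |[A,A,0]|^{151/80}.\]
   Context: The Heisenberg group $H_1(\mathbb{F}_p)$ consists of the matrices $[x,y,z]=\begin{bmatrix}1&x&z\\0&1&y\\0&0&1\end{bmatrix}$, $x,y,z\in\mathbb{F}_p$, with matrix multiplication, so $[x,y,z][x',y',z']=[x+x',y+y',z+z'+xy']$. $[A,A,0]=\{[x,y,0]:x,y\in A\}$ and $[A,A,0][A,A,0]=\{mm':m,m'\in[A,A,0]\}$. Notation: $X\ll Y$ means $X\le CY$ for an absolute constant $C>0$; $X\lesssim Y$ means $X\ll (\log Y)^{C'}Y$ for some absolute constant $C'>0$; and $X\gtrsim Y$ means $Y\lesssim X$.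
   Formalization: In the relation ≳ the logarithm log X is read as max(1, log X); this matters only for the trivial subgroup A={1}, where the literal inequality 1 ≤ C(log 1)^{C'} fails. *)

theory Defs
  imports Complex_Main "HOL-Number_Theory.Residues" "HOL-Algebra.Coset"
    "HOL-Analysis.Cartesian_Space"
begin

text \<open>Matrices over the carrier of a ring \<open>R\<close>. The type \<open>'a ^ 3 ^ 3\<close> only supplies the
  indexing: all ring operations are those of \<open>R\<close>, since the prime \<open>p\<close> has to be quantified
  inside the statement and so \<open>F\<^sub>p\<close> is the record \<open>residue_ring (int p)\<close>, not a type.\<close>

definition mat3_mult :: "('a, 'm) ring_scheme \<Rightarrow> 'a ^ 3 ^ 3 \<Rightarrow> 'a ^ 3 ^ 3 \<Rightarrow> 'a ^ 3 ^ 3" where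
  "mat3_mult R M N = (\<chi> i j. \<Oplus>\<^bsub>R\<^esub>k\<in>UNIV. M $ i $ k \<otimes>\<^bsub>R\<^esub> N $ k $ j)"

definition heis :: "('a::zero, 'm) ring_scheme \<Rightarrow> 'a \<Rightarrow> 'a \<Rightarrow> 'a \<Rightarrow> 'a ^ 3 ^ 3" where
  "heis R x y z =
     vector [vector [\<one>\<^bsub>R\<^esub>, x, z],
             vector [\<zero>\<^bsub>R\<^esub>, \<one>\<^bsub>R\<^esub>, y],
             vector [\<zero>\<^bsub>R\<^esub>, \<zero>\<^bsub>R\<^esub>, \<one>\<^bsub>R\<^esub>]]"

definition heisenberg_group :: "('a::zero, 'm) ring_scheme \<Rightarrow> ('a ^ 3 ^ 3) monoid" where
  "heisenberg_group R =
     \<lparr>carrier = {heis R x y z | x y z. x \<in> carrier R \<and> y \<in> carrier R \<and> z \<in> carrier R},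
      monoid.mult = mat3_mult R,
      monoid.one = heis R \<zero>\<^bsub>R\<^esub> \<zero>\<^bsub>R\<^esub> \<zero>\<^bsub>R\<^esub>\<rparr>"

definition heis_box :: "('a::zero, 'm) ring_scheme \<Rightarrow> 'a set \<Rightarrow> ('a ^ 3 ^ 3) set" where
  "heis_box R A = {heis R x y \<zero>\<^bsub>R\<^esub> | x y. x \<in> A \<and> y \<in> A}"

text \<open>The relation \<open>X \<lesssim> Y\<close> with its two absolute constants made explicit. The logarithm is
  read as \<open>max 1 (ln Y)\<close>, which is \<open>ln Y\<close> for \<open>Y \<ge> e\<close>; with a bare \<open>ln Y\<close> the relation would
  fail for \<open>X = Y = 1\<close>, which is what the trivial subgroup \<open>A = {1}\<close> gives.\<close>

definition lesssim :: "real \<Rightarrow> real \<Rightarrow> real \<Rightarrow> real \<Rightarrow> bool" where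
  "lesssim C C' X Y \<longleftrightarrow> X \<le> C * ((max 1 (ln Y)) powr C' * Y)"

abbreviation gtrsim :: "real \<Rightarrow> real \<Rightarrow> real \<Rightarrow> real \<Rightarrow> bool" where
  "gtrsim C C' X Y \<equiv> lesssim C C' Y X"

lemma mat3_mult_heis:
  fixes R :: "('a::zero, 'm) ring_scheme" (structure)
  assumes "cring R"
    and "x \<in> carrier R" "y \<in> carrier R" "z \<in> carrier R"
    and "x' \<in> carrier R" "y' \<in> carrier R" "z' \<in> carrier R"
  shows "mat3_mult R (heis R x y z) (heis R x' y' z') =
    heis R (x \<oplus> x') (y \<oplus> y') (z \<oplus> z' \<oplus> x \<otimes> y')"
proof -
  interpret cring R by fact
  have fin: "(\<Oplus>k\<in>UNIV. f k) = f 1 \<oplus> (f 2 \<oplus> f 3)" if "\<And>k. f k \<in> carrier R" for f :: "3 \<Rightarrow> 'a"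
  proof -
    have "(1::3) \<notin> {2, 3}" "(2::3) \<notin> {3}" by simp_all
    then have "finsum R f (insert 1 (insert 2 (insert 3 {}))) = f 1 \<oplus> (f 2 \<oplus> (f 3 \<oplus> \<zero>))"
      by (subst finsum_insert; (simp only: finsum_empty Pi_def that finite.intros)?)+
        (auto simp: that)
    then show ?thesis using that by (simp only: UNIV_3 r_zero)
  qed
  have c: "heis R a b c $ i $ j \<in> carrier R"
    if "a \<in> carrier R" "b \<in> carrier R" "c \<in> carrier R" for a b c :: 'a and i j :: 3
    using that exhaust_3[of i] exhaust_3[of j] by (auto simp: heis_def)
  have e: "heis R a b c $ 1 $ 1 = \<one>" "heis R a b c $ 1 $ 2 = a" "heis R a b c $ 1 $ 3 = c"
    "heis R a b c $ 2 $ 1 = \<zero>" "heis R a b c $ 2 $ 2 = \<one>" "heis R a b c $ 2 $ 3 = b"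
    "heis R a b c $ 3 $ 1 = \<zero>" "heis R a b c $ 3 $ 2 = \<zero>" "heis R a b c $ 3 $ 3 = \<one>"
    for a b c by (simp_all add: heis_def)
  have "mat3_mult R (heis R x y z) (heis R x' y' z') $ i $ j =
    heis R (x \<oplus> x') (y \<oplus> y') (z \<oplus> z' \<oplus> x \<otimes> y') $ i $ j" for i j
  proof -
    have "mat3_mult R (heis R x y z) (heis R x' y' z') $ i $ j =
      heis R x y z $ i $ 1 \<otimes> heis R x' y' z' $ 1 $ j \<oplus>
      (heis R x y z $ i $ 2 \<otimes> heis R x' y' z' $ 2 $ j \<oplus>
       heis R x y z $ i $ 3 \<otimes> heis R x' y' z' $ 3 $ j)"
      unfolding mat3_mult_def vec_lambda_beta using assms by (intro fin m_closed c) auto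
    then show ?thesis
      using assms exhaust_3[of i] exhaust_3[of j] by (elim disjE) (simp_all add: e a_ac)
  qed
  then show ?thesis by (simp add: vec_eq_iff)
qed

lemma heisenberg_group_is_group:
  fixes R :: "('a::zero, 'm) ring_scheme" (structure)
  assumes "cring R"
  shows "group (heisenberg_group R)"
proof -
  interpret cring R by fact
  note mat3_mult_heis = mat3_mult_heis[OF assms]
  show ?thesis
  proof (rule groupI)
    fix g h assume "g \<in> carrier (heisenberg_group R)" "h \<in> carrier (heisenberg_group R)"
    then show "g \<otimes>\<^bsub>heisenberg_group R\<^esub> h \<in> carrier (heisenberg_group R)"
      unfolding heisenberg_group_def by (clarsimp simp: mat3_mult_heis) (metis a_closed m_closed)
  next
    show "\<one>\<^bsub>heisenberg_group R\<^esub> \<in> carrier (heisenberg_group R)"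
      by (auto simp: heisenberg_group_def)
  next
    fix g h k assume "g \<in> carrier (heisenberg_group R)" "h \<in> carrier (heisenberg_group R)"
      "k \<in> carrier (heisenberg_group R)"
    then show "g \<otimes>\<^bsub>heisenberg_group R\<^esub> h \<otimes>\<^bsub>heisenberg_group R\<^esub> k =
      g \<otimes>\<^bsub>heisenberg_group R\<^esub> (h \<otimes>\<^bsub>heisenberg_group R\<^esub> k)"
      by (auto simp: heisenberg_group_def mat3_mult_heis l_distr r_distr a_ac)
  next
    fix g assume "g \<in> carrier (heisenberg_group R)"
    then show "\<one>\<^bsub>heisenberg_group R\<^esub> \<otimes>\<^bsub>heisenberg_group R\<^esub> g = g"
      by (auto simp: heisenberg_group_def mat3_mult_heis)
  next
    fix g assume "g \<in> carrier (heisenberg_group R)"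
    then obtain x y z where g: "g = heis R x y z" "x \<in> carrier R" "y \<in> carrier R" "z \<in> carrier R"
      by (auto simp: heisenberg_group_def)
    define w where "w = x \<otimes> y"
    have w: "w \<in> carrier R" "\<ominus> x \<otimes> y = \<ominus> w"
      using g by (simp_all add: w_def l_minus)
    have "\<ominus> z \<oplus> w \<oplus> z = w \<oplus> (\<ominus> z \<oplus> z)"
      using g(4) w(1) by (simp only: a_comm[of "\<ominus> z" w] a_assoc a_inv_closed)
    then have "\<ominus> z \<oplus> w \<oplus> z \<oplus> \<ominus> w = \<zero>"
      using g(4) w(1) by (simp add: l_neg r_neg)
    then have "mat3_mult R (heis R (\<ominus> x) (\<ominus> y) (\<ominus> z \<oplus> w)) g = heis R \<zero> \<zero> \<zero>"
      using g w by (simp add: mat3_mult_heis l_neg)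
    moreover have "heis R (\<ominus> x) (\<ominus> y) (\<ominus> z \<oplus> w) \<in> carrier (heisenberg_group R)"
      using g w unfolding heisenberg_group_def by (simp, blast intro: a_inv_closed a_closed)
    ultimately show "\<exists>h\<in>carrier (heisenberg_group R).
      h \<otimes>\<^bsub>heisenberg_group R\<^esub> g = \<one>\<^bsub>heisenberg_group R\<^esub>"
      by (intro bexI) (simp_all add: heisenberg_group_def)
  qed
qed

end

theory Submission
  imports Defs "HOL-Computational_Algebra.Computational_Algebra" "HOL-Analysis.Convex"
    "HOL-Real_Asymp.Real_Asymp"
begin

text \<open>Let \<open>n = |A|\<close>. The product set has as many elements as the map
  \<open>(x, x', y, y') \<mapsto> (x + x', y + y', x y')\<close> has values on \<open>A\<^sup>4\<close>, so by Cauchy--Schwarz it suffices to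
  bound the number of collisions. Dividing by elements of \<open>A\<close>, a collision is a pair of elements of
  \<open>A\<close> together with some \<open>l \<in> A\<close> and two representations \<open>l - 1 = b - a\<close> with \<open>a, b \<in> A\<close>; the number
  of collisions is therefore at most \<open>n\<^sup>2\<close> times the sum over \<open>l \<in> A\<close> of the squares \<open>r(l)\<^sup>2\<close> of the
  numbers of such representations.

  For \<open>l \<noteq> 1\<close> each representation gives a point \<open>x = b / (l - 1)\<close> with
  \<open>x\<^sup>n = (x - 1)\<^sup>n = c\<close>, where \<open>c = (l - 1)\<^sup>-\<^sup>n\<close>. The number of such points over any set of \<open>s\<close>
  levels \<open>c\<close> is \<open>O((n s) ^ (2/3))\<close> by Stepanov's method in the form of Heath-Brown and Konyagin: one
  takes a combination of the \<open>X\<^sup>k X\<^sup>n\<^sup>i (X - 1)\<^sup>n\<^sup>j\<close> vanishing to high order at all these points.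
  It is nonzero since a polynomial of degree less than \<open>p\<close> with at most \<open>n\<close> terms is not divisible
  by \<open>(X - 1)\<^sup>n\<close>. With \<open>s = 1\<close> and \<open>s = n ^ (1/4)\<close> the sum of the \<open>r(l)\<^sup>2\<close> is \<open>O(n ^ (13/6))\<close>, hence
  the product set has at least a constant times \<open>n ^ (23/6)\<close> elements, and \<open>23/6 > 151/40\<close>.

  Since \<open>p\<close> is quantified inside the statement there is no type for the field with \<open>p\<close> elements;
  polynomials over it are integer polynomials modulo the prime element \<open>[:p:]\<close>.\<close>

subsection \<open>Vanishing orders of integer polynomials modulo a prime\<close>

lemma const_dvd_poly: 
  fixes f :: "int poly" 
  assumes "[:p:] dvd f" shows "p dvd poly f x"
  using assms by (auto elim!: dvdE)

lemma linear_factor_mod: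
  fixes q :: "int poly"
  assumes "p dvd poly q x"
  obtains q' where "[:p:] dvd q - [:-x, 1:] * q'"
proof -
  have "q - [:-x, 1:] * synthetic_div q x = [:poly q x:]"
    using synthetic_div_correct'[of x q] by (simp add: algebra_simps)
  with assms that[of "synthetic_div q x"] show ?thesis
    by simp
qed

text \<open>Induction on \<open>m\<close>. For an exponent e of the support, the operator X d/dX - e
  removes the term of exponent e, keeps every other term nonzero modulo \<open>p\<close> because
  exponents below \<open>p\<close> stay distinct there, and lowers the order of vanishing at 1 by at
  most one.\<close>

lemma sparse_vanishing_order:
  fixes p :: int and f h :: "int poly"
  assumes p: "prime p" and "int (degree f) < p" and "\<not> [:p:] dvd f"
    and "[:p:] dvd f - [:-1, 1:] ^ m * h"
  shows "m < card {i. \<not> p dvd coeff f i}"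
  using assms(2-)
proof (induction m arbitrary: f h)
  case 0
  have "finite {i. \<not> p dvd coeff f i}"
    by (rule finite_subset[of _ "{..degree f}"]) (auto intro: le_degree)
  with 0 show ?case by (auto simp: card_gt_0_iff const_poly_dvd_iff)
next
  case (Suc m)
  define S where "S = {i. \<not> p dvd coeff f i}"
  have fin: "finite S"
    unfolding S_def by (rule finite_subset[of _ "{..degree f}"]) (auto intro: le_degree)
  obtain e where e: "e \<in> S" using Suc.prems by (auto simp: S_def const_poly_dvd_iff)
  define g where "g = [:0, 1:] * pderiv f - of_nat e * f"
  have cg: "coeff g i = (int i - int e) * coeff f i" for i
    by (cases i) (auto simp: g_def coeff_pderiv of_nat_poly algebra_simps)
  have small: "p dvd (int i - int e) \<longleftrightarrow> i = e" if "i \<in> S" for i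
  proof
    assume d: "p dvd int i - int e"
    have "i \<le> degree f" "e \<le> degree f" using that e by (auto simp: S_def intro: le_degree)
    then have "\<bar>int i - int e\<bar> < p" using Suc.prems by linarith
    with d show "i = e" using zdvd_imp_le[of p "\<bar>int i - int e\<bar>"] by fastforce
  qed simp
  have Sg: "{i. \<not> p dvd coeff g i} = S - {e}"
    using small p by (auto simp: S_def cg prime_dvd_mult_iff)
  have "degree g \<le> degree f"
    by (rule degree_le) (auto simp: cg coeff_eq_0)
  then have dg: "int (degree g) < p" using Suc.prems by linarith
  obtain r where r: "f = [:-1, 1:] ^ Suc m * h + [:p:] * r"
    using Suc.prems(3) by (metis add.commute diff_add_cancel dvdE)
  have pd: "pderiv ([:-1, 1:] ^ Suc m :: int poly) = of_nat (Suc m) * [:-1, 1:] ^ m"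
    unfolding pderiv_power_Suc by (simp add: pderiv_pCons of_nat_poly)
  have "g - [:-1, 1:] ^ m * ([:0,1:] * (of_nat (Suc m) * h + [:-1,1:] * pderiv h) - of_nat e * [:-1,1:] * h)
     = [:p:] * ([:0,1:] * pderiv r - of_nat e * r)"
    unfolding g_def r pderiv_add pderiv_mult pd by (simp add: pderiv_pCons algebra_simps)
  then have dv: "[:p:] dvd g - [:-1, 1:] ^ m * ([:0,1:] * (of_nat (Suc m) * h + [:-1,1:] * pderiv h) - of_nat e * [:-1,1:] * h)"
    by (rule dvdI)
  have cS: "card S = Suc (card (S - {e}))" using fin e by (rule card.remove)
  have "Suc m < card S"
  proof (cases "[:p:] dvd g")
    case False
    from Suc.IH[OF dg False dv] show ?thesis by (simp add: Sg cS)
  next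
    \<comment> \<open>Now \<open>f\<close> is the single term of exponent \<open>e\<close> modulo
      \<open>p\<close>; its value at 1 is its coefficient, which must vanish because the order at 1
      is positive. This contradicts the choice of \<open>e\<close>.\<close>
    case True
    then have "S - {e} = {}" unfolding Sg[symmetric] by (auto simp: const_poly_dvd_iff)
    then have z: "p dvd coeff f i" if "i \<noteq> e" for i using that by (auto simp: S_def)
    have "[:p:] dvd f - monom (coeff f e) e"
      using z by (auto simp: const_poly_dvd_iff)
    from const_dvd_poly[OF this, of 1] have "p dvd poly f 1 - coeff f e"
      by (simp add: poly_monom)
    moreover have "p dvd poly f 1" using const_dvd_poly[OF Suc.prems(3), of 1] by simp
    ultimately have "p dvd coeff f e" by (metis dvd_diff_right_iff)
    then show ?thesis using e by (simp add: S_def)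
  qed
  then show ?case by (simp add: S_def)
qed

text \<open>Divisibility of \<open>f\<close> by (X - x)^m over the field with \<open>p\<close>
  elements, lifted to integer polynomials by a congruence modulo \<open>[:p:]\<close>.\<close>

definition vanishes_mod :: "int \<Rightarrow> nat \<Rightarrow> int \<Rightarrow> int poly \<Rightarrow> bool" where
  "vanishes_mod p m x f \<longleftrightarrow> (\<exists>q. [:p:] dvd f - [:-x, 1:] ^ m * q)"

text \<open>Gauss's lemma; it permits cancelling factors not divisible by \<open>[:p:]\<close> in
  congruences.\<close>

lemma prime_elem_const_int: "prime p \<Longrightarrow> prime_elem [:p::int:]"
  unfolding prime_elem_const_poly_iff by (rule prime_imp_prime_elem)

lemma not_const_dvd_linear_power:
  assumes "prime (p::int)" shows "\<not> [:p:] dvd [:-x, 1:] ^ m"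
proof
  assume "[:p:] dvd [:-x, 1:] ^ m"
  then have "[:p:] dvd [:-x, 1:]" using prime_elem_dvd_power prime_elem_const_int assms by blast
  then have "p dvd coeff [:-x, 1:] 1" unfolding const_poly_dvd_iff by blast
  then show False using assms by (auto simp: not_prime_unit)
qed

text \<open>Since \<open>G\<close> is a unit at \<open>y\<close>, a zero of \<open>G * q\<close>
  there comes from \<open>q\<close>. Peel one factor X - y off \<open>q\<close>, cancel it in the
  congruence and use induction on \<open>m\<close>.\<close>

lemma vanishes_mod_cancel:
  assumes p: "prime p" and G: "\<not> p dvd poly G y" and "vanishes_mod p m y (G * q)"
  shows "vanishes_mod p m y q"
  using assms(3)
proof (induction m arbitrary: q)
  case 0
  show ?case by (auto simp: vanishes_mod_def intro!: exI[of _ q])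
next
  case (Suc m)
  then obtain h where h: "[:p:] dvd G * q - [:-y, 1:] ^ Suc m * h" by (auto simp: vanishes_mod_def)
  from const_dvd_poly[OF this, of y] have "p dvd poly q y"
    using G p by (simp add: prime_dvd_mult_iff)
  then obtain q1 where q1: "[:p:] dvd q - [:-y, 1:] * q1" by (rule linear_factor_mod)
  have "[:p:] dvd (G * q - [:-y, 1:] ^ Suc m * h) - G * (q - [:-y, 1:] * q1)"
    by (rule dvd_diff[OF h dvd_mult[OF q1]])
  \<comment> \<open>The exponent 1 makes the linear factor an instance of
    \<open>not_const_dvd_linear_power\<close>.\<close>
  also have "\<dots> = [:-y, 1:] ^ 1 * (G * q1 - [:-y, 1:] ^ m * h)"
    by (simp add: algebra_simps)
  finally have "[:p:] dvd G * q1 - [:-y, 1:] ^ m * h"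
    using prime_elem_dvd_multD[OF prime_elem_const_int[OF p]] not_const_dvd_linear_power[OF p] by blast
  then have "vanishes_mod p m y q1" using Suc.IH by (auto simp: vanishes_mod_def)
  then obtain q2 where q2: "[:p:] dvd q1 - [:-y, 1:] ^ m * q2" by (auto simp: vanishes_mod_def)
  have "[:p:] dvd (q - [:-y, 1:] * q1) + [:-y, 1:] * (q1 - [:-y, 1:] ^ m * q2)"
    by (rule dvd_add[OF q1 dvd_mult[OF q2]])
  also have "\<dots> = q - [:-y, 1:] ^ Suc m * q2" by (simp add: algebra_simps)
  finally show ?case by (auto simp: vanishes_mod_def)
qed

lemma vanishes_mod_cong:
  assumes "[:p:] dvd f - g" "vanishes_mod p m x f" shows "vanishes_mod p m x g"
proof -
  obtain q where q: "[:p:] dvd f - [:-x, 1:] ^ m * q" using assms by (auto simp: vanishes_mod_def)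
  have "[:p:] dvd (f - [:-x, 1:] ^ m * q) - (f - g)" by (rule dvd_diff[OF q assms(1)])
  also have "\<dots> = g - [:-x, 1:] ^ m * q" by simp
  finally have "[:p:] dvd g - [:-x, 1:] ^ m * q" .
  then show ?thesis by (auto simp: vanishes_mod_def)
qed

text \<open>Dividing by X - x at a point of positive order lowers the degree and the order at x by
  one. The other orders survive, because X - x does not vanish modulo \<open>p\<close> at the other
  points of \<open>R\<close>.\<close>

lemma sum_vanishing_orders_le_degree:
  assumes p: "prime p" and "finite R" and R: "\<And>x y. x \<in> R \<Longrightarrow> y \<in> R \<Longrightarrow> p dvd x - y \<Longrightarrow> x = y"
    and "\<not> [:p:] dvd f" and "\<And>x. x \<in> R \<Longrightarrow> vanishes_mod p (m x) x f"
  shows "sum m R \<le> degree f"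
  using assms(4-)
proof (induction "degree f" arbitrary: f m rule: less_induct)
  case less
  show ?case
  proof (cases "\<exists>x\<in>R. m x \<noteq> 0")
    case False
    then show ?thesis by simp
  next
    case True
    then obtain x k where x: "x \<in> R" "m x = Suc k" by (metis not0_implies_Suc)
    from less.prems(2)[OF x(1)] obtain h where h: "[:p:] dvd f - [:-x, 1:] ^ Suc k * h"
      by (auto simp: vanishes_mod_def x)
    from const_dvd_poly[OF this, of x] have px: "p dvd poly f x" by simp
    define q where "q = synthetic_div f x"
    have fq: "f = [:-x, 1:] * q + [:poly f x:]"
      unfolding q_def using synthetic_div_correct'[of x f] by simp
    have dfq: "[:p:] dvd f - [:-x, 1:] * q" using px by (subst (1) fq) (simp add: algebra_simps)
    have nq: "\<not> [:p:] dvd q"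
      using dfq less.prems(1) by (metis dvd_diffD dvd_mult diff_add_cancel dvd_add)
    have "degree f \<noteq> 0"
    proof
      assume "degree f = 0"
      then obtain c where "f = [:c:]" by (auto elim: degree_eq_zeroE)
      with px less.prems(1) show False by simp
    qed
    moreover have dq: "degree q = degree f - 1" by (simp add: q_def degree_synthetic_div)
    ultimately have lt: "degree q < degree f" by simp
    have "sum (m(x := k)) R \<le> degree q"
    proof (rule less.hyps[OF lt nq])
      fix y assume y: "y \<in> R"
      show "vanishes_mod p ((m(x := k)) y) y q"
      proof (cases "y = x")
        case True
        have "[:p:] dvd (f - [:-x, 1:] ^ Suc k * h) - (f - [:-x, 1:] * q)"
          using h dfq by (rule dvd_diff)
        also have "\<dots> = [:-x, 1:] ^ 1 * (q - [:-x, 1:] ^ k * h)" by (simp add: algebra_simps)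
        finally have "[:p:] dvd q - [:-x, 1:] ^ k * h"
          using prime_elem_dvd_multD[OF prime_elem_const_int[OF p]] not_const_dvd_linear_power[OF p] by blast
        then show ?thesis using True by (auto simp: vanishes_mod_def)
      next
        case False
        have "vanishes_mod p (m y) y ([:-x, 1:] * q)"
          using vanishes_mod_cong[OF dfq] less.prems(2)[OF y] by blast
        moreover have "\<not> p dvd poly [:-x, 1:] y" using R[OF y x(1)] False by (auto simp: algebra_simps)
        ultimately have "vanishes_mod p (m y) y q" by (rule vanishes_mod_cancel[OF p, rotated])
        then show ?thesis using False by (simp only: fun_upd_other[OF False])
      qed
    qed
    moreover have "sum m R = Suc (sum (m(x := k)) R)"
      using x sum.remove[OF \<open>finite R\<close> x(1), of m] sum.remove[OF \<open>finite R\<close> x(1), of "m(x := k)"]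
      by (simp add: sum.cong[of "R - {x}" "R - {x}" "m(x := k)" m])
    ultimately show ?thesis using lt by simp
  qed
qed

subsection \<open>Derivations and linear systems modulo a prime\<close>

text \<open>Using \<open>X (X - 1) d/dX\<close> instead of \<open>d/dX\<close> makes every \<open>f X\<^sup>i (X - 1)\<^sup>j\<close> reproduce itself with a new
  polynomial factor (\<open>twist i j f\<close>), whose degree grows by one per step. Away from the
  roots 0 and 1 of \<open>X (X - 1)\<close> both operators detect the same order of vanishing.\<close>

definition tder :: "int poly \<Rightarrow> int poly" where
  "tder f = [:0, -1, 1:] * pderiv f"

definition twist :: "nat \<Rightarrow> nat \<Rightarrow> int poly \<Rightarrow> int poly" where
  "twist i j f = tder f + (of_nat i * [:-1, 1:] + of_nat j * [:0, 1:]) * f"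

lemma tder_add: "tder (f + g) = tder f + tder g"
  by (simp add: tder_def pderiv_add algebra_simps)

lemma tder_diff: "tder (f - g) = tder f - tder g"
  by (simp add: tder_def pderiv_diff algebra_simps)

lemma tder_mult: "tder (f * g) = tder f * g + f * tder g"
  by (simp add: tder_def pderiv_mult algebra_simps)

lemma funpow_additive:
  fixes T :: "'a::ab_group_add \<Rightarrow> 'a"
  assumes "\<And>f g. T (f + g) = T f + T g"
  shows "(T ^^ k) (f + g) = (T ^^ k) f + (T ^^ k) g"
  by (induction k) (simp_all add: assms)

lemma funpow_additive_diff:
  fixes T :: "'a::ab_group_add \<Rightarrow> 'a"
  assumes "\<And>f g. T (f - g) = T f - T g"
  shows "(T ^^ k) (f - g) = (T ^^ k) f - (T ^^ k) g"
  by (induction k) (simp_all add: assms)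

lemma tder_linear_power: "tder ([:-x, 1:] ^ Suc m) = of_nat (Suc m) * [:0, -1, 1:] * [:-x, 1:] ^ m"
proof -
  have "pderiv ([:-x, 1:] ^ Suc m) = of_nat (Suc m) * [:-x, 1:] ^ m"
    unfolding pderiv_power_Suc by (simp add: pderiv_pCons of_nat_poly)
  then show ?thesis unfolding tder_def by (simp only: mult_ac)
qed

lemma tder_X_power: "tder ([:0, 1:] ^ e) = of_nat e * [:-1, 1:] * [:0, 1:] ^ e"
proof (cases e)
  case 0 then show ?thesis by (simp add: tder_def)
next
  case (Suc m)
  have w: "[:0, -1, 1:] = [:0, 1:] * [:-1, 1::int:]" by simp
  show ?thesis using tder_linear_power[of 0 m] unfolding Suc w by (simp only: minus_zero power_Suc mult_ac)
qed

lemma tder_X_minus_1_power: "tder ([:-1, 1:] ^ e) = of_nat e * [:0, 1:] * [:-1, 1:] ^ e"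
proof (cases e)
  case 0 then show ?thesis by (simp add: tder_def)
next
  case (Suc m)
  have w: "[:0, -1, 1:] = [:0, 1:] * [:-1, 1::int:]" by simp
  show ?thesis using tder_linear_power[of 1 m] unfolding Suc w by (simp only: power_Suc mult_ac)
qed

lemma tder_twist: "tder (f * ([:0, 1:] ^ i * [:-1, 1:] ^ j)) = twist i j f * ([:0, 1:] ^ i * [:-1, 1:] ^ j)"
  unfolding tder_mult tder_X_power tder_X_minus_1_power twist_def by (simp only: algebra_simps)

lemma funpow_tder_twist:
  "(tder ^^ k) (f * ([:0, 1:] ^ i * [:-1, 1:] ^ j)) = (twist i j ^^ k) f * ([:0, 1:] ^ i * [:-1, 1:] ^ j)"
  by (induction k) (simp_all only: funpow.simps comp_apply id_apply tder_twist)

lemma funpow_tder_sum: "(tder ^^ k) (\<Sum>i\<in>I. f i) = (\<Sum>i\<in>I. (tder ^^ k) (f i))"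
proof (induction I rule: infinite_finite_induct)
  case (insert i I)
  then show ?case by (simp add: funpow_additive tder_add)
\<comment> \<open>The empty and the infinite index set both need that the iterate maps 0 to 0,
  obtained from 0 = 0 - 0.\<close>
qed (use funpow_additive_diff[of tder k 0 0, OF tder_diff] in simp_all)

lemma twist_diff: "twist i j (f - g) = twist i j f - twist i j g"
  by (simp add: twist_def tder_diff algebra_simps)

lemma degree_twist: "degree f < a \<Longrightarrow> degree (twist i j f) < Suc a"
proof -
  assume a: "degree f < a"
  have "degree (tder f) \<le> a"
  \<comment> \<open>Constants are separate: adding the degrees of the factors would give 2, which
    exceeds \<open>a\<close> when \<open>a\<close> is 1.\<close>
  proof (cases "degree f = 0")
    case True
    then show ?thesis by (auto simp: tder_def elim!: degree_eq_zeroE)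
  next
    case False
    have "degree (tder f) \<le> degree [:0, -1, 1::int:] + degree (pderiv f)"
      unfolding tder_def by (rule degree_mult_le)
    also have "\<dots> \<le> a" using a False by (simp add: degree_pderiv)
    finally show ?thesis .
  qed
  moreover have "degree ((of_nat i * [:-1, 1:] + of_nat j * [:0, 1:]) * f) \<le> a"
  proof -
    have e: "of_nat i * [:-1, 1:] + of_nat j * [:0, 1:] = [:- int i, int i + int j:]"
      by (simp add: of_nat_poly)
    have "degree ([:- int i, int i + int j:] * f) \<le> degree [:- int i, int i + int j:] + degree f"
      by (rule degree_mult_le)
    also have "\<dots> \<le> 1 + degree f" by simp
    finally show ?thesis unfolding e using a by linarith
  qed
  ultimately have "degree (twist i j f) \<le> a" unfolding twist_def by (intro degree_add_le)
  then show ?thesis by simp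
qed

lemma degree_funpow_twist: "degree f < a \<Longrightarrow> degree ((twist i j ^^ k) f) < a + k"
  by (induction k) (auto intro: degree_twist)

text \<open>Each application strips one factor X - x from the power and multiplies the cofactor at x
  by the old exponent and x (x - 1); the term with the derivative of the cofactor still contains X -
  x and contributes nothing at x.\<close>

lemma poly_funpow_tder_linear_power:
  "poly ((tder ^^ m) ([:-x, 1:] ^ m * q)) x = fact m * (x * (x - 1)) ^ m * poly q x"
proof (induction m arbitrary: q)
  case (Suc m)
  have "tder ([:-x, 1:] ^ Suc m * q)
      = [:-x, 1:] ^ m * (of_nat (Suc m) * [:0, -1, 1:] * q + [:-x, 1:] * tder q)"
    unfolding tder_mult tder_linear_power by (simp only: power_Suc algebra_simps)
  then have "(tder ^^ Suc m) ([:-x, 1:] ^ Suc m * q)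
      = (tder ^^ m) ([:-x, 1:] ^ m * (of_nat (Suc m) * [:0, -1, 1:] * q + [:-x, 1:] * tder q))"
    by (simp only: funpow_Suc_right comp_apply)
  also have "poly \<dots> x = fact (Suc m) * (x * (x - 1)) ^ Suc m * poly q x"
    unfolding Suc.IH by (simp add: algebra_simps)
  finally show ?case .
qed simp

lemma const_dvd_funpow_tder: "[:p:] dvd f \<Longrightarrow> [:p:] dvd (tder ^^ k) f"
proof (induction k)
  case (Suc k)
  then obtain g where g: "(tder ^^ k) f = [:p:] * g" by (auto elim: dvdE)
  have "(tder ^^ Suc k) f = [:p:] * tder g"
    by (simp add: g tder_def pderiv_smult)
  then show ?case by (rule dvdI)
qed simp

text \<open>If f is (X - x)^m q modulo \<open>p\<close>, the m-th iterate at x is m! (x (x - 1))^m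
  q(x). For m < D the factor before q(x) is a unit, since m < p and x is neither 0 nor 1 modulo
  \<open>p\<close>; hence q(x) vanishes and the order rises by one.\<close>

lemma vanishes_mod_if_funpow_tder:
  assumes p: "prime p" and x: "\<not> p dvd x" "\<not> p dvd x - 1" and "int D \<le> p"
    and D: "\<And>k. k < D \<Longrightarrow> p dvd poly ((tder ^^ k) f) x"
  shows "vanishes_mod p D x f"
proof -
  have "m \<le> D \<Longrightarrow> vanishes_mod p m x f" for m
  proof (induction m)
    case 0 show ?case by (auto simp: vanishes_mod_def intro!: exI[of _ f])
  next
    case (Suc m)
    then obtain q where q: "[:p:] dvd f - [:-x, 1:] ^ m * q" by (auto simp: vanishes_mod_def)
    have "p dvd poly ((tder ^^ m) (f - [:-x, 1:] ^ m * q)) x"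
      using const_dvd_poly const_dvd_funpow_tder q by blast
    then have "p dvd poly ((tder ^^ m) f) x - fact m * (x * (x - 1)) ^ m * poly q x"
      by (simp only: funpow_additive_diff[of tder, OF tder_diff] poly_diff poly_funpow_tder_linear_power)
    moreover have "p dvd poly ((tder ^^ m) f) x" using D Suc.prems by simp
    ultimately have "p dvd fact m * (x * (x - 1)) ^ m * poly q x" by (metis dvd_diff_right_iff)
    moreover have "\<not> p dvd fact m"
    proof
      assume "p dvd fact m"
      moreover have "prime (nat p)" "int (nat p) = p" using p by (auto simp: prime_ge_0_int)
      ultimately have "nat p dvd fact m" by (metis int_dvd_int_iff of_nat_fact)
      then have "nat p \<le> m" using \<open>prime (nat p)\<close> prime_dvd_fact_iff by blast
      with Suc.prems \<open>int D \<le> p\<close> show False by linarith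
    qed
    moreover have "\<not> p dvd (x * (x - 1)) ^ m"
      using x p by (metis prime_dvd_mult_iff prime_dvd_power)
    ultimately have "p dvd poly q x" using p by (metis prime_dvd_mult_iff)
    then obtain q1 where q1: "[:p:] dvd q - [:-x, 1:] * q1" by (rule linear_factor_mod)
    have "[:p:] dvd (f - [:-x, 1:] ^ m * q) + [:-x, 1:] ^ m * (q - [:-x, 1:] * q1)"
      by (rule dvd_add[OF q dvd_mult[OF q1]])
    also have "\<dots> = f - [:-x, 1:] ^ Suc m * q1" by (simp add: algebra_simps)
    finally show ?case by (auto simp: vanishes_mod_def)
  qed
  then show ?thesis by simp
qed

text \<open>Pigeonhole: there are more vectors of residues indexed by \<open>I\<close> than value
  vectors indexed by \<open>J\<close>, so two distinct vectors have the same values, and their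
  difference is the solution.\<close>

lemma nontrivial_solution_mod:
  fixes F :: "('i \<Rightarrow> int) \<Rightarrow> 'j \<Rightarrow> int" and p :: int
  assumes "p > 1" "finite I" "finite J" "card J < card I"
    and F: "\<And>u v j. F (\<lambda>i. u i - v i) j = F u j - F v j"
  obtains w where "\<exists>i\<in>I. \<not> p dvd w i" "\<And>j. j \<in> J \<Longrightarrow> p dvd F w j"
proof -
  define U where "U = I \<rightarrow>\<^sub>E {0..<p}"
  define V where "V = J \<rightarrow>\<^sub>E {0..<p}"
  define H where "H u = restrict (\<lambda>j. F u j mod p) J" for u
  have HV: "H ` U \<subseteq> V" using \<open>p > 1\<close> by (auto simp: H_def V_def)
  have cU: "card U = nat p ^ card I" using assms by (simp add: U_def card_PiE)
  have cV: "card V = nat p ^ card J" using assms by (simp add: V_def card_PiE)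
  have "finite V" using assms by (simp add: V_def finite_PiE)
  then have "card (H ` U) \<le> card V" using HV by (rule card_mono)
  also have "\<dots> < card U" unfolding cU cV using assms by (intro power_strict_increasing) auto
  finally have "\<not> inj_on H U" by (rule pigeonhole)
  then obtain u v where uv: "u \<in> U" "v \<in> U" "H u = H v" "u \<noteq> v" by (auto simp: inj_on_def)
  show ?thesis
  proof (rule that[of "\<lambda>i. u i - v i"])
    obtain i where i: "i \<in> I" "u i \<noteq> v i"
      using uv by (metis PiE_ext U_def)
    then have "u i \<in> {0..<p}" "v i \<in> {0..<p}" using uv by (auto simp: U_def)
    then have "\<bar>u i - v i\<bar> < p" by auto
    then have "\<not> p dvd u i - v i" using i zdvd_imp_le[of p "\<bar>u i - v i\<bar>"] by fastforce
    with i show "\<exists>i\<in>I. \<not> p dvd u i - v i" by blast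
  next
    fix j assume "j \<in> J"
    then have "F u j mod p = F v j mod p" using fun_cong[OF uv(3), of j] by (simp add: H_def)
    then show "p dvd F (\<lambda>i. u i - v i) j" unfolding F by (simp add: mod_eq_dvd_iff)
  qed
qed

subsection \<open>Stepanov's method\<close>

definition block_poly :: "nat \<Rightarrow> (nat \<times> nat \<times> nat \<Rightarrow> int) \<Rightarrow> nat \<Rightarrow> nat \<Rightarrow> int poly" where
  "block_poly a w i j = (\<Sum>k<a. monom (w (k, i, j)) k)"

text \<open>Where X^n and (X - 1)^n both equal c modulo \<open>p\<close>, the high powers become c^i
  and c^j, so that only the low-degree blocks remain. This is what keeps the number of vanishing
  conditions small.\<close>

definition auxiliary_poly :: "nat \<Rightarrow> nat \<Rightarrow> nat \<Rightarrow> (nat \<times> nat \<times> nat \<Rightarrow> int) \<Rightarrow> int poly" where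
  "auxiliary_poly n a b w =
     (\<Sum>i<b. \<Sum>j<b. block_poly a w i j * ([:0, 1:] ^ (n * i) * [:-1, 1:] ^ (n * j)))"

lemma block_poly_diff:
  "block_poly a (\<lambda>t. u t - v t) i j = block_poly a u i j - block_poly a v i j"
  by (simp add: block_poly_def sum_subtractf flip: diff_monom)

lemma degree_block_poly: "0 < a \<Longrightarrow> degree (block_poly a w i j) < a"
proof -
  assume "0 < a"
  have "degree (block_poly a w i j) \<le> a - 1"
    unfolding block_poly_def using \<open>0 < a\<close>
    by (intro degree_sum_le) (auto intro: order_trans[OF degree_monom_le])
  with \<open>0 < a\<close> show ?thesis by linarith
qed

text \<open>Sort by powers of (X - 1)^n, with coefficients \<open>G j\<close> of degree below
  \<open>p\<close> and at most a b terms. If the sum vanished modulo \<open>p\<close>, the first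
  nonzero \<open>G J\<close> would be divisible by (X - 1)^n and hence have more than n
  terms.\<close>

lemma auxiliary_poly_not_dvd:
  fixes p :: int
  assumes p: "prime p" and ab: "a * b \<le> n" and nb: "int (n * b) \<le> p"
    and w: "k0 < a" "i0 < b" "j0 < b" "\<not> p dvd w (k0, i0, j0)"
  shows "\<not> [:p:] dvd auxiliary_poly n a b w"
proof
  assume dvd: "[:p:] dvd auxiliary_poly n a b w"
  define K where "K = {..<a} \<times> {..<b}"
  define e where "e = (\<lambda>(k, i). k + n * i)"
  define G where "G j = (\<Sum>t\<in>K. monom (w (fst t, snd t, j)) (e t))" for j
  \<comment> \<open>This makes k the remainder and i the quotient of k + n i by n, so the exponents
    are distinct.\<close>
  have an: "a \<le> n" using ab w by (metis le_trans less_imp_Suc_add mult.commute le_add1 mult_Suc)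
  have inj: "inj_on e K"
  proof (rule inj_onI)
    fix s t assume "s \<in> K" "t \<in> K" "e s = e t"
    moreover obtain k i k' i' where "s = (k, i)" "t = (k', i')" by (metis surj_pair)
    ultimately have k: "k < n" "k' < n" "k + n * i = k' + n * i'" "s = (k, i)" "t = (k', i')"
      using an by (auto simp: K_def e_def)
    have "k = (k + n * i) mod n" "k' = (k' + n * i') mod n" using k(1,2) by simp_all
    then have "k = k'" using k(3) by simp
    with k show "s = t" by simp
  qed
  have finK: "finite K" and cK: "card K = a * b" by (auto simp: K_def)
  have cG: "coeff (G j) r = (\<Sum>t\<in>K. if e t = r then w (fst t, snd t, j) else 0)" for j r
    by (simp add: G_def coeff_sum)
  have cG_e: "coeff (G j) (e t) = w (fst t, snd t, j)" if "t \<in> K" for j t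
  proof -
    have "coeff (G j) (e t) = (\<Sum>s\<in>K. if s = t then w (fst s, snd s, j) else 0)"
      unfolding cG using inj_on_eq_iff[OF inj _ that] by (intro sum.cong refl) simp
    then show ?thesis using that finK by (simp add: sum.delta)
  qed
  have suppG: "r \<in> e ` K" if "coeff (G j) r \<noteq> 0" for j r
  proof (rule ccontr)
    assume "r \<notin> e ` K"
    then have "coeff (G j) r = 0" unfolding cG by (intro sum.neutral) auto
    with that show False by simp
  qed
  have cardG: "card {r. \<not> p dvd coeff (G j) r} \<le> n" for j
  proof -
    have "card {r. \<not> p dvd coeff (G j) r} \<le> card (e ` K)"
      using suppG finK by (intro card_mono) (auto, metis dvd_0_right)
    also have "\<dots> \<le> n" using card_image_le[OF finK, of e] ab cK by simp
    finally show ?thesis .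
  qed
  have lt: "e t < n * b" if tK: "t \<in> K" for t
  proof -
    obtain k i where t: "t = (k, i)" "k < a" "i < b" using tK by (auto simp: K_def)
    have "k + n * i < n * Suc i" using t an by simp
    also have "\<dots> \<le> n * b" using t by (intro mult_left_mono) auto
    finally show ?thesis using t by (simp add: e_def)
  qed
  have degG: "int (degree (G j)) < p" for j
  proof -
    have "degree (G j) \<le> n * b - 1"
      unfolding G_def
    proof (rule degree_sum_le[OF finK])
      fix t assume "t \<in> K"
      then show "degree (monom (w (fst t, snd t, j)) (e t)) \<le> n * b - 1"
        using lt[of t] degree_monom_le[of "w (fst t, snd t, j)" "e t"] by linarith
    qed
    moreover have "0 < n * b" using w an by simp
    ultimately show ?thesis using nb by linarith
  qed
  have Psi: "auxiliary_poly n a b w = (\<Sum>j<b. G j * [:-1, 1:] ^ (n * j))"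
  proof -
    have "G j = (\<Sum>i<b. block_poly a w i j * [:0, 1:] ^ (n * i))" for j
    proof -
      have "G j = (\<Sum>k<a. \<Sum>i<b. monom (w (k, i, j)) (k + n * i))"
        by (simp add: G_def K_def e_def sum.cartesian_product case_prod_beta)
      also have "\<dots> = (\<Sum>i<b. \<Sum>k<a. monom (w (k, i, j)) (k + n * i))" by (rule sum.swap)
      also have "\<dots> = (\<Sum>i<b. block_poly a w i j * [:0, 1:] ^ (n * i))"
        unfolding block_poly_def sum_distrib_right
        by (intro sum.cong refl) (simp add: mult_monom flip: monom_altdef[of 1, simplified])
      finally show ?thesis .
    qed
    then show ?thesis unfolding auxiliary_poly_def
      by (subst sum.swap) (simp add: sum_distrib_right mult.assoc)
  qed
  define J where "J = (LEAST j. j < b \<and> \<not> [:p:] dvd G j)"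
  have "j0 < b \<and> \<not> [:p:] dvd G j0"
    using w cG_e[of "(k0, i0)" j0] by (auto simp: const_poly_dvd_iff K_def intro!: exI[of _ "e (k0, i0)"])
  then have "J < b \<and> \<not> [:p:] dvd G J"
    unfolding J_def by (rule LeastI)
  then have J: "J < b" "\<not> [:p:] dvd G J" by auto
  have Jmin: "[:p:] dvd G j" if "j < J" for j
    using not_less_Least[of j "\<lambda>j. j < b \<and> \<not> [:p:] dvd G j"] that J(1) by (auto simp flip: J_def)
  \<comment> \<open>The terms after \<open>J\<close>, divided by (X - 1)^(n (J + 1)).\<close>
  define H where "H = (\<Sum>j\<in>{J<..<b}. G j * [:-1, 1:] ^ (n * (j - Suc J)))"
  have split: "{..<b} = {..<J} \<union> ({J} \<union> {J<..<b})" using J by auto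
  have "(\<Sum>j<b. G j * [:-1, 1:] ^ (n * j)) = (\<Sum>j<J. G j * [:-1, 1:] ^ (n * j))
     + (G J * [:-1, 1:] ^ (n * J) + (\<Sum>j\<in>{J<..<b}. G j * [:-1, 1:] ^ (n * j)))"
    unfolding split by (subst sum.union_disjoint; force?)+ 
  also have "(\<Sum>j\<in>{J<..<b}. G j * [:-1, 1:] ^ (n * j)) = [:-1, 1:] ^ (n * J) * ([:-1, 1:] ^ n * H)"
    unfolding H_def sum_distrib_left
  proof (intro sum.cong refl)
    fix j assume "j \<in> {J<..<b}"
    then have "n * j = n * J + (n + n * (j - Suc J))"
      by (auto simp flip: distrib_left mult_Suc_right)
    then show "G j * [:-1, 1:] ^ (n * j) = [:-1, 1:] ^ (n * J) * ([:-1, 1:] ^ n * (G j * [:-1, 1:] ^ (n * (j - Suc J))))"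
      by (simp only: power_add mult_ac)
  qed
  finally have "auxiliary_poly n a b w = (\<Sum>j<J. G j * [:-1, 1:] ^ (n * j)) + [:-1, 1:] ^ (n * J) * (G J - [:-1, 1:] ^ n * (- H))"
    unfolding Psi by (simp only: algebra_simps)
  moreover have "[:p:] dvd (\<Sum>j<J. G j * [:-1, 1:] ^ (n * j))"
    by (rule dvd_sum, rule dvd_mult2, rule Jmin) simp
  ultimately have "[:p:] dvd [:-1, 1:] ^ (n * J) * (G J - [:-1, 1:] ^ n * (- H))"
    using dvd by (simp only: dvd_add_right_iff)
  then have "[:p:] dvd G J - [:-1, 1:] ^ n * (- H)"
    using prime_elem_dvd_multD[OF prime_elem_const_int[OF p]] not_const_dvd_linear_power[OF p, of 1 "n * J"] by metis
  then have "n < card {r. \<not> p dvd coeff (G J) r}"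
    by (rule sparse_vanishing_order[OF p degG J(2)])
  with cardG[of J] show False by simp
qed

lemma degree_auxiliary_poly:
  assumes "0 < a" "0 < b" "a \<le> 2 * n"
  shows "degree (auxiliary_poly n a b w) \<le> 2 * n * b"
  unfolding auxiliary_poly_def
proof (intro degree_sum_le ballI)
  fix i j assume ij: "i \<in> {..<b}" "j \<in> {..<b}"
  have "degree ([:0, 1::int:] ^ (n * i)) \<le> n * i" "degree ([:-1, 1::int:] ^ (n * j)) \<le> n * j"
    by (rule order_trans[OF degree_power_le], simp)+
  then have "degree (block_poly a w i j * ([:0, 1:] ^ (n * i) * [:-1, 1:] ^ (n * j))) \<le> a + (n * i + n * j)"
    using degree_block_poly[OF assms(1), of w i j]
    by (intro order_trans[OF degree_mult_le] add_mono) auto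
  also have "\<dots> \<le> 2 * n + (n * (b - 1) + n * (b - 1))"
    using ij assms by (intro add_mono mult_left_mono) auto
  also have "\<dots> = 2 * n * b" using assms by (cases b) auto
  finally show "degree (block_poly a w i j * ([:0, 1:] ^ (n * i) * [:-1, 1:] ^ (n * j))) \<le> 2 * n * b" .
qed auto

text \<open>There are a b^2 unknown coefficients and at most |C| D (a + D) linear conditions, so a
  nontrivial choice satisfies them all. The resulting polynomial vanishes to order \<open>D\<close>
  at every point of \<open>R\<close>, while its degree is at most 2 n b.\<close>

lemma stepanov_bound:
  fixes p :: int and C R :: "int set"
  assumes p: "prime p" and "finite C" and "card C * (D * (a + D)) < a * b\<^sup>2"
    and ab: "a * b \<le> n" and nb: "int (n * b) \<le> p" and D: "int D \<le> p"
    and R: "R \<subseteq> {2..<p}"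
    and RC: "\<And>x. x \<in> R \<Longrightarrow> \<exists>c\<in>C. [x ^ n = c] (mod p) \<and> [(x - 1) ^ n = c] (mod p)"
  shows "D * card R \<le> 2 * n * b"
proof -
  have a0: "0 < a" and b0: "0 < b" using assms(3) by (auto intro!: Nat.gr0I)
  \<comment> \<open>At a point of level c this agrees modulo \<open>p\<close> with the k-th iterated
    derivation of the auxiliary polynomial. It depends linearly on \<open>u\<close> and, for k < D,
    has fewer than a + D coefficients; requiring them to vanish gives the linear system.\<close>
  define Q where "Q u c k = (\<Sum>i<b. \<Sum>j<b. smult (c ^ (i + j)) ((twist (n * i) (n * j) ^^ k) (block_poly a u i j)))" for u c k
  define F where "F u = (\<lambda>(c, k, r). coeff (Q u c k) r)" for u
  have "Q (\<lambda>t. u t - v t) c k = Q u c k - Q v c k" for u v c k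
    by (simp add: Q_def block_poly_diff funpow_additive_diff twist_diff smult_diff_right sum_subtractf)
  then have F: "F (\<lambda>t. u t - v t) s = F u s - F v s" for u v s
    by (simp add: F_def case_prod_beta)
  have "p > 1" using p by (rule prime_gt_1_int)
  moreover have "card (C \<times> {..<D} \<times> {..<a + D}) < card ({..<a} \<times> {..<b} \<times> {..<b})"
    using assms(3) by (simp add: card_cartesian_product power2_eq_square)
  ultimately obtain w where w: "\<exists>t\<in>{..<a} \<times> {..<b} \<times> {..<b}. \<not> p dvd w t"
    and wF: "\<And>s. s \<in> C \<times> {..<D} \<times> {..<a + D} \<Longrightarrow> p dvd F w s"
    using nontrivial_solution_mod[of p "{..<a} \<times> {..<b} \<times> {..<b}" "C \<times> {..<D} \<times> {..<a + D}" F, OF _ _ _ _ F]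
      \<open>finite C\<close> by (metis finite_SigmaI finite_lessThan)
  define f where "f = auxiliary_poly n a b w"
  have nf: "\<not> [:p:] dvd f" unfolding f_def using w auxiliary_poly_not_dvd[OF p ab nb] by fastforce
  have finR: "finite R" using R finite_subset by blast
  have "(\<Sum>x\<in>R. D) \<le> degree f"
  proof (rule sum_vanishing_orders_le_degree[OF p finR _ nf])
    fix x y assume "x \<in> R" "y \<in> R" "p dvd x - y"
    moreover have "x \<in> {2..<p}" "y \<in> {2..<p}" using calculation(1,2) R by blast+
    then have "\<bar>x - y\<bar> < p" by auto
    ultimately show "x = y" using dvd_imp_le_int[of "x - y" p] by linarith
  next
    fix x assume x: "x \<in> R"
    then have x2: "2 \<le> x" "x < p" using R by auto
    show "vanishes_mod p D x f"
    proof (rule vanishes_mod_if_funpow_tder[OF p _ _ D])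
      show "\<not> p dvd x" using x2 zdvd_imp_le[of p x] by auto
      show "\<not> p dvd x - 1" using x2 zdvd_imp_le[of p "x - 1"] by auto
      fix k assume k: "k < D"
      obtain c where c: "c \<in> C" "[x ^ n = c] (mod p)" "[(x - 1) ^ n = c] (mod p)" using RC x by blast
      have dQ: "degree (Q w c k) < a + D"
      proof -
        have "degree (Q w c k) \<le> a + k"
          unfolding Q_def using degree_funpow_twist[OF degree_block_poly[OF a0]]
          by (intro degree_sum_le order_trans[OF degree_smult_le]) (auto intro: less_imp_le)
        then show ?thesis using k by simp
      qed
      have "[:p:] dvd Q w c k"
        unfolding const_poly_dvd_iff
      proof
        fix r
        show "p dvd coeff (Q w c k) r"
        proof (cases "r < a + D")
          case True
          then show ?thesis using wF[of "(c, k, r)"] c k by (simp add: F_def)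
        next
          case False
          then show ?thesis using dQ by (simp add: coeff_eq_0)
        qed
      qed
      then have "[poly (Q w c k) x = 0] (mod p)"
        by (simp add: cong_0_iff const_dvd_poly)
      moreover have "[poly ((tder ^^ k) f) x = poly (Q w c k) x] (mod p)"
      proof -
        have "poly ((tder ^^ k) f) x = (\<Sum>i<b. \<Sum>j<b. poly ((twist (n * i) (n * j) ^^ k) (block_poly a w i j)) x
            * ((x ^ n) ^ i * ((x - 1) ^ n) ^ j))"
          by (simp add: f_def auxiliary_poly_def funpow_tder_sum funpow_tder_twist poly_sum flip: power_mult)
        moreover have "poly (Q w c k) x = (\<Sum>i<b. \<Sum>j<b. poly ((twist (n * i) (n * j) ^^ k) (block_poly a w i j)) x
            * (c ^ i * c ^ j))"
          by (simp add: Q_def poly_sum power_add mult_ac)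
        ultimately show ?thesis using c
          by (auto intro!: cong_sum cong_mult cong_pow)
      qed
      ultimately show "p dvd poly ((tder ^^ k) f) x" using cong_trans cong_0_iff by blast
    qed
  qed
  also have "a \<le> 2 * n" using ab b0 by (metis le_trans le_add1 mult_2 mult_le_mono2 mult.right_neutral Suc_leI One_nat_def)
  then have "degree f \<le> 2 * n * b" unfolding f_def using a0 b0 by (intro degree_auxiliary_poly)
  finally show ?thesis by (simp add: mult.commute)
qed

subsection \<open>Collisions for multiplicative subgroups\<close>

text \<open>Cauchy-Schwarz over the fibres of \<open>f\<close>: their sizes sum to |X|, and the
  squares of the sizes sum to the number of collisions.\<close>

lemma card_squared_le_card_image_times_collisions:
  assumes "finite X"
  shows "(card X)\<^sup>2 \<le> card (f ` X) * card {(x, y). x \<in> X \<and> y \<in> X \<and> f x = f y}"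
proof -
  define N where "N z = card {y \<in> X. f y = z}" for z
  have "{(x, y). x \<in> X \<and> y \<in> X \<and> f x = f y} = Sigma X (\<lambda>x. {y \<in> X. f y = f x})" by auto
  then have "card {(x, y). x \<in> X \<and> y \<in> X \<and> f x = f y} = (\<Sum>x\<in>X. N (f x))"
    using assms by (simp add: N_def)
  also have "\<dots> = (\<Sum>z\<in>f ` X. \<Sum>x\<in>{x \<in> X. f x = z}. N (f x))"
    by (rule sum.image_gen[OF assms])
  also have "\<dots> = (\<Sum>z\<in>f ` X. (N z)\<^sup>2)"
    by (simp add: N_def power2_eq_square)
  finally have 1: "card {(x, y). x \<in> X \<and> y \<in> X \<and> f x = f y} = (\<Sum>z\<in>f ` X. (N z)\<^sup>2)" .
  have 2: "card X = (\<Sum>z\<in>f ` X. N z)"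
    using sum.image_gen[OF assms, of "\<lambda>_. 1::nat" f] by (simp add: N_def)
  have "(\<Sum>z\<in>f ` X. real (N z))\<^sup>2 \<le> (\<Sum>z\<in>f ` X. (real (N z))\<^sup>2) * real (card (f ` X))"
    using sum_squared_le_sum_of_squares[of "\<lambda>z. real (N z)" "f ` X"] assms by simp
  then have "real ((card X)\<^sup>2) \<le> real (card (f ` X) * (\<Sum>z\<in>f ` X. (N z)\<^sup>2))"
    unfolding 2 by (simp add: mult.commute)
  then show ?thesis unfolding 1 by linarith
qed

locale subgroup_mod =
  fixes p :: int and A :: "int set"
  assumes prime_p: "prime p" and A_subset: "A \<subseteq> {1..<p}" and one_in: "1 \<in> A"
    and mult_in: "x \<in> A \<Longrightarrow> y \<in> A \<Longrightarrow> x * y mod p \<in> A"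
    and inverse_in: "x \<in> A \<Longrightarrow> \<exists>y\<in>A. [x * y = 1] (mod p)"
begin

text \<open>The coordinates of the product [x, y, 0] [x', y', 0]; note the order of the
  arguments.\<close>

definition heis_coords :: "int \<times> int \<times> int \<times> int \<Rightarrow> int \<times> int \<times> int" where
  "heis_coords = (\<lambda>(x, x', y, y'). ((x + x') mod p, (y + y') mod p, x * y' mod p))"

definition reps :: "int \<Rightarrow> (int \<times> int) set" where
  "reps l = {(a, b). a \<in> A \<and> b \<in> A \<and> [l - 1 = b - a] (mod p)}"

text \<open>Starting the range at 2 keeps both x and x - 1 invertible modulo
  \<open>p\<close>.\<close>

definition sols :: "int \<Rightarrow> int set" where
  "sols c = {x \<in> {2..<p}. [x ^ card A = c] (mod p) \<and> [(x - 1) ^ card A = c] (mod p)}"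

lemma finite_A: "finite A" using A_subset finite_subset by blast

lemma finite_reps: "finite (reps l)"
  by (rule finite_subset[of _ "A \<times> A"]) (auto simp: reps_def finite_A)

lemma finite_sols: "finite (sols c)"
  by (rule finite_subset[of _ "{2..<p}"]) (auto simp: sols_def)

lemma mod_A: "x \<in> A \<Longrightarrow> x mod p = x"
  using A_subset by (auto intro!: mod_pos_pos_trivial)

lemma not_dvd_A: "x \<in> A \<Longrightarrow> \<not> p dvd x"
  using A_subset zdvd_imp_le[of p x] by fastforce

lemma cong_A_eq: "x \<in> A \<Longrightarrow> y \<in> A \<Longrightarrow> [x = y] (mod p) \<Longrightarrow> x = y"
  by (simp add: Cong.cong_def mod_A)

lemma card_A_pos: "0 < card A" using one_in finite_A by (auto simp: card_gt_0_iff)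

text \<open>Multiplication by \<open>a\<close> permutes \<open>A\<close>, so it preserves the
  product over \<open>A\<close>, which is invertible and can be cancelled.\<close>

lemma power_card_cong_1:
  assumes "a \<in> A" shows "[a ^ card A = 1] (mod p)"
proof -
  have cop: "coprime x p" if "x \<in> A" for x
    using prime_p not_dvd_A[OF that] by (simp add: prime_imp_coprime coprime_commute)
  have inj: "inj_on (\<lambda>x. a * x mod p) A"
  proof (rule inj_onI)
    fix x y assume "x \<in> A" "y \<in> A" "a * x mod p = a * y mod p"
    then show "x = y" using cong_mult_lcancel[OF cop[OF assms]] cong_A_eq by (auto simp: Cong.cong_def)
  qed
  moreover have "(\<lambda>x. a * x mod p) ` A \<subseteq> A" using mult_in assms by auto
  ultimately have im: "(\<lambda>x. a * x mod p) ` A = A" using finite_A by (metis endo_inj_surj)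
  have "[prod (\<lambda>x. x) A = prod (\<lambda>x. a * x mod p) A] (mod p)"
    using prod.reindex[OF inj, of "\<lambda>x. x"] im by simp
  also have "[prod (\<lambda>x. a * x mod p) A = prod (\<lambda>x. a * x) A] (mod p)"
    by (rule cong_prod) simp
  also have "prod (\<lambda>x. a * x) A = a ^ card A * prod (\<lambda>x. x) A"
    by (simp add: prod.distrib)
  finally have "[a ^ card A * prod (\<lambda>x. x) A = 1 * prod (\<lambda>x. x) A] (mod p)"
    by (simp add: cong_sym_eq)
  moreover have "coprime (prod (\<lambda>x. x) A) p" using cop by (rule prod_coprime_left)
  ultimately show ?thesis using cong_mult_rcancel by blast
qed

text \<open>For a collision of (x, x', y, y') and (u, u', v, v') put l = x/u = v'/y'. Dividing the
  first equation by u and the second by y' gives l - 1 = u'/u - x'/u = y/y' - v/y'. So u, y', l and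
  two representations determine the collision.\<close>

lemma card_collisions_le:
  "card {(s, t). s \<in> A \<times> A \<times> A \<times> A \<and> t \<in> A \<times> A \<times> A \<times> A \<and> heis_coords s = heis_coords t}
     \<le> (card A)\<^sup>2 * (\<Sum>l\<in>A. (card (reps l))\<^sup>2)"
proof -
  \<comment> \<open>Recovers the collision from \<open>t\<close> = y', (a, b) = (x'/u, u'/u) and (d,
    c) = (v/y', y/y').\<close>
  define h where "h = (\<lambda>(u, t, l, (a, b), (d, c)).
     ((l * u mod p, a * u mod p, c * t mod p, t), (u, b * u mod p, d * t mod p, l * t mod p)))"
  define Z where "Z = A \<times> A \<times> Sigma A (\<lambda>l. reps l \<times> reps l)"
  have "{(s, t). s \<in> A \<times> A \<times> A \<times> A \<and> t \<in> A \<times> A \<times> A \<times> A \<and> heis_coords s = heis_coords t} \<subseteq> h ` Z"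
  proof clarify
    fix x x' y y' u u' v v'
    assume A: "x \<in> A" "x' \<in> A" "y \<in> A" "y' \<in> A" "u \<in> A" "u' \<in> A" "v \<in> A" "v' \<in> A"
      and "heis_coords (x, x', y, y') = heis_coords (u, u', v, v')"
    then have e: "p dvd (x + x') - (u + u')" "p dvd (y + y') - (v + v')" "p dvd x * y' - u * v'"
      by (auto simp: heis_coords_def mod_eq_dvd_iff)
    obtain w where w: "w \<in> A" "p dvd u * w - 1"
      using inverse_in[OF \<open>u \<in> A\<close>] by (auto simp: cong_iff_dvd_diff)
    obtain z where z: "z \<in> A" "p dvd y' * z - 1"
      using inverse_in[OF \<open>y' \<in> A\<close>] by (auto simp: cong_iff_dvd_diff)
    define l where "l = x * w mod p"
    have mw: "r * w mod p * u mod p = r" if "r \<in> A" for r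
    proof -
      have "p dvd r * (u * w - 1)" using w by simp
      then have "r * w * u mod p = r mod p" by (simp add: mod_eq_dvd_iff algebra_simps)
      then show ?thesis using mod_A[OF that] by (simp add: mod_simps)
    qed
    have mz: "r * z mod p * y' mod p = r" if "r \<in> A" for r
    proof -
      have "p dvd r * (y' * z - 1)" using z by simp
      then have "r * z * y' mod p = r mod p" by (simp add: mod_eq_dvd_iff algebra_simps)
      then show ?thesis using mod_A[OF that] by (simp add: mod_simps)
    qed
    have v': "p dvd v' - x * w * y'"
    proof -
      have "p dvd w * (u * v' - x * y') - v' * (u * w - 1)"
        using e(3) by (intro dvd_diff[OF dvd_mult dvd_mult[OF w(2)]]) (simp only: dvd_diff_commute)
      then show ?thesis by (simp add: algebra_simps)
    qed
    then have lv: "l * y' mod p = v'"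
      using mod_A[OF \<open>v' \<in> A\<close>] by (simp add: l_def mod_simps mod_eq_dvd_iff[symmetric])
    have 1: "(x' * w mod p, u' * w mod p) \<in> reps l"
    proof -
      have "p dvd w * ((x + x') - (u + u')) + (u * w - 1)" by (rule dvd_add[OF dvd_mult[OF e(1)] w(2)])
      then have "p dvd (x * w - 1) - (u' * w - x' * w)" by (simp add: algebra_simps)
      then have "[l - 1 = u' * w mod p - x' * w mod p] (mod p)"
        unfolding l_def Cong.cong_def mod_diff_eq unfolding mod_diff_left_eq mod_eq_dvd_iff .
      then show ?thesis using A w mult_in by (simp add: reps_def)
    qed
    have 2: "(v * z mod p, y * z mod p) \<in> reps l"
    proof -
      \<comment> \<open>This combination eliminates v' and all terms containing y' z.\<close>
      have "p dvd (y' * z - 1) - z * ((y + y') - (v + v')) - z * (v' - x * w * y') - (x * w) * (y' * z - 1)"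
        by (rule dvd_diff[OF dvd_diff[OF dvd_diff[OF z(2) dvd_mult[OF e(2)]] dvd_mult[OF v']] dvd_mult[OF z(2)]])
      then have "p dvd (x * w - 1) - (y * z - v * z)" by (simp add: algebra_simps)
      then have "[l - 1 = y * z mod p - v * z mod p] (mod p)"
        unfolding l_def Cong.cong_def mod_diff_eq unfolding mod_diff_left_eq mod_eq_dvd_iff .
      then show ?thesis using A z mult_in by (simp add: reps_def)
    qed
    have "h (u, y', l, (x' * w mod p, u' * w mod p), (v * z mod p, y * z mod p))
        = ((x, x', y, y'), (u, u', v, v'))"
      using A by (simp add: h_def l_def[symmetric] lv mw mz) (simp add: l_def mw)
    moreover have "(u, y', l, (x' * w mod p, u' * w mod p), (v * z mod p, y * z mod p)) \<in> Z"
      using A w mult_in 1 2 by (simp add: Z_def l_def)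
    ultimately show "((x, x', y, y'), (u, u', v, v')) \<in> h ` Z" by (metis image_eqI)
  qed
  moreover have finZ: "finite Z" unfolding Z_def using finite_A finite_reps by auto
  ultimately have "card {(s, t). s \<in> A \<times> A \<times> A \<times> A \<and> t \<in> A \<times> A \<times> A \<times> A \<and> heis_coords s = heis_coords t}
      \<le> card (h ` Z)" by (intro card_mono) auto
  also have "\<dots> \<le> card Z" by (rule card_image_le[OF finZ])
  also have "card Z = (card A)\<^sup>2 * (\<Sum>l\<in>A. (card (reps l))\<^sup>2)"
    using finite_A finite_reps by (simp add: Z_def card_cartesian_product power2_eq_square)
  finally show ?thesis .
qed

section \<open>From representations of l - 1 to points on level sets\<close>

lemma card_reps_1: "card (reps 1) \<le> card A"
proof -
  have "reps 1 \<subseteq> (\<lambda>a. (a, a)) ` A"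
    using cong_A_eq by (auto simp: reps_def cong_iff_dvd_diff)
  then have "card (reps 1) \<le> card ((\<lambda>a. (a, a)) ` A)" using finite_A by (intro card_mono) auto
  also have "\<dots> \<le> card A" using finite_A by (rule card_image_le)
  finally show ?thesis .
qed

definition inverse_pred :: "int \<Rightarrow> int" where
  "inverse_pred l = (SOME z. [(l - 1) * z = 1] (mod p))"

lemma inverse_pred: 
  assumes "l \<in> A" "l \<noteq> 1" shows "[(l - 1) * inverse_pred l = 1] (mod p)"
proof -
  have "\<not> p dvd l - 1" using assms cong_A_eq[OF _ one_in] by (auto simp: cong_iff_dvd_diff)
  then have "coprime (l - 1) p" using prime_p by (simp add: prime_imp_coprime coprime_commute)
  then have "\<exists>z. [(l - 1) * z = 1] (mod p)" by (rule cong_solve_coprime_int)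
  then show ?thesis unfolding inverse_pred_def by (rule someI_ex)
qed

text \<open>The value of (l - 1)^(-n) with n = |A|, reduced modulo \<open>p\<close> so that distinct
  levels are incongruent.\<close>

definition level :: "int \<Rightarrow> int" where
  "level l = inverse_pred l ^ card A mod p"

text \<open>With x = b/(l - 1) one has x - 1 = a/(l - 1). Since a^n = b^n = 1 for n = |A|, both n-th
  powers equal the level of \<open>l\<close>.\<close>

lemma reps_to_sols:
  assumes l: "l \<in> A" "l \<noteq> 1" and ab: "(a, b) \<in> reps l"
  shows "b * inverse_pred l mod p \<in> sols (level l)"
proof -
  define z where "z = inverse_pred l"
  have z: "[(l - 1) * z = 1] (mod p)" using inverse_pred[OF l] by (simp add: z_def)
  have a: "a \<in> A" "b \<in> A" "[l - 1 = b - a] (mod p)" using ab by (auto simp: reps_def)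
  define x where "x = b * z mod p"
  have bz: "[b * z - 1 = a * z] (mod p)"
  proof -
    have "p dvd ((l - 1) * z - 1) - z * ((l - 1) - (b - a))"
      using z a(3) unfolding cong_iff_dvd_diff by (rule dvd_diff[OF _ dvd_mult])
    then show ?thesis by (simp add: cong_iff_dvd_diff algebra_simps)
  qed
  have nz: "\<not> p dvd z"
  proof
    assume "p dvd z"
    then have "p dvd (l - 1) * z" by simp
    then have "p dvd 1" using z by (meson cong_dvd_iff dvd_refl cong_sym cong_0_iff cong_trans)
    then show False using prime_p by (simp add: not_prime_unit)
  qed
  have x: "[x = b * z] (mod p)" "[x - 1 = a * z] (mod p)"
    using bz by (simp_all add: x_def Cong.cong_def mod_simps)
  have "\<not> p dvd b * z" "\<not> p dvd a * z"
    using nz not_dvd_A a prime_p by (auto simp: prime_dvd_mult_iff)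
  then have "\<not> p dvd x" "\<not> p dvd x - 1"
    using x cong_dvd_iff by (metis cong_0_iff cong_sym cong_trans)+
  moreover have "0 \<le> x" "x < p" using prime_p by (simp_all add: x_def prime_gt_0_int)
  ultimately have "x \<in> {2..<p}" by (cases "x = 0"; cases "x = 1") auto
  moreover have "[x ^ card A = z ^ card A] (mod p)"
    using cong_trans[OF cong_pow[OF x(1)]] cong_mult[OF power_card_cong_1[OF a(2)] cong_refl[of "z ^ card A"]]
    by (simp add: power_mult_distrib)
  moreover have "[(x - 1) ^ card A = z ^ card A] (mod p)"
    using cong_trans[OF cong_pow[OF x(2)]] cong_mult[OF power_card_cong_1[OF a(1)] cong_refl[of "z ^ card A"]]
    by (simp add: power_mult_distrib)
  ultimately show ?thesis by (simp add: sols_def level_def x_def z_def)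
qed

lemma cancel_inverse_pred:
  assumes "l \<in> A" "l \<noteq> 1" "[a * inverse_pred l = b * inverse_pred l] (mod p)"
  shows "[a = b] (mod p)"
proof -
  have "coprime ((l - 1) * inverse_pred l) p"
    using inverse_pred[OF assms(1,2)] by (metis cong_imp_coprime cong_sym coprime_1_left)
  then show ?thesis using assms(3) cong_mult_rcancel by auto
qed

lemma card_reps_le:
  assumes "l \<in> A" "l \<noteq> 1"
  shows "card (reps l) \<le> card (sols (level l))"
proof (rule card_inj_on_le[OF _ _ finite_sols])
  show "inj_on (\<lambda>(a, b). b * inverse_pred l mod p) (reps l)"
  proof (rule inj_onI, clarify)
    fix a b a' b' assume ab: "(a, b) \<in> reps l" "(a', b') \<in> reps l"
      and "b * inverse_pred l mod p = b' * inverse_pred l mod p"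
    then have "[b = b'] (mod p)" unfolding Cong.cong_def[symmetric] by - (rule cancel_inverse_pred[OF assms])
    moreover have abA: "a \<in> A" "b \<in> A" "a' \<in> A" "b' \<in> A"
      and c: "[l - 1 = b - a] (mod p)" "[l - 1 = b' - a'] (mod p)" using ab unfolding reps_def by blast+
    ultimately have b: "b = b'" using cong_A_eq by blast
    have "[b - a = b - a'] (mod p)" using c b by (simp add: Cong.cong_def)
    then have "[a = a'] (mod p)" by (simp add: cong_iff_dvd_diff dvd_diff_commute)
    then show "a = a' \<and> b = b'" using b abA cong_A_eq by blast
  qed
  show "(\<lambda>(a, b). b * inverse_pred l mod p) ` reps l \<subseteq> sols (level l)"
    using reps_to_sols[OF assms] by auto
qed

text \<open>The representation (1, l) of l - 1 gives the point l/(l - 1) = 1 + 1/(l - 1), which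
  determines \<open>l\<close>.\<close>

lemma card_level_in_le:
  assumes "finite C"
  shows "card {l \<in> A - {1}. level l \<in> C} \<le> card (\<Union>c\<in>C. sols c)"
proof (rule card_inj_on_le[of "\<lambda>l. l * inverse_pred l mod p"])
  show "inj_on (\<lambda>l. l * inverse_pred l mod p) {l \<in> A - {1}. level l \<in> C}"
  proof (rule inj_onI)
    fix l k assume lk: "l \<in> {l \<in> A - {1}. level l \<in> C}" "k \<in> {l \<in> A - {1}. level l \<in> C}"
      "l * inverse_pred l mod p = k * inverse_pred k mod p"
    define y z where "y = inverse_pred l" and "z = inverse_pred k"
    have 1: "p dvd (l - 1) * y - 1" "p dvd (k - 1) * z - 1" "p dvd l * y - k * z"
      using lk inverse_pred by (auto simp: y_def z_def cong_iff_dvd_diff mod_eq_dvd_iff)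
    have yz: "p dvd y - z"
    proof -
      have "p dvd (l * y - k * z) - ((l - 1) * y - 1) + ((k - 1) * z - 1)"
        by (rule dvd_add[OF dvd_diff[OF 1(3,1)] 1(2)])
      then show ?thesis by (simp add: algebra_simps)
    qed
    have "p dvd (l * y - k * z) - k * (y - z)" by (rule dvd_diff[OF 1(3) dvd_mult[OF yz]])
    then have "[l * inverse_pred l = k * inverse_pred l] (mod p)"
      by (simp add: cong_iff_dvd_diff y_def[symmetric] algebra_simps)
    then have "[l = k] (mod p)" using cancel_inverse_pred lk(1) by blast
    then show "l = k" using lk(1,2) cong_A_eq by blast
  qed
  show "(\<lambda>l. l * inverse_pred l mod p) ` {l \<in> A - {1}. level l \<in> C} \<subseteq> (\<Union>c\<in>C. sols c)"
    using reps_to_sols[of _ 1] one_in by (auto simp: reps_def)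
qed (simp add: assms finite_sols)

end

subsection \<open>The growth bound\<close>

context subgroup_mod begin

lemma card_UN_sols_le:
  assumes "finite C" "card C * (D * (a + D)) < a * b\<^sup>2" "a * b \<le> card A"
    "int (card A * b) \<le> p" "int D \<le> p"
  shows "D * card (\<Union>c\<in>C. sols c) \<le> 2 * card A * b"
  by (rule stepanov_bound[OF prime_p assms]) (auto simp: sols_def)

text \<open>Here \<open>m\<close> is of size \<open>n ^ (1/12)\<close> with \<open>n = card A\<close>. Stepanov's bound is used twice: for a single
  level with \<open>a = D = m ^ 8\<close>, \<open>b = 2 m ^ 4\<close>, and for \<open>m ^ 3\<close> levels with \<open>a = D = m ^ 7\<close>, \<open>b = 2 m ^ 5\<close>.\<close>

lemma sum_reps_squared_le:
  assumes m: "0 < m" and lower: "2 * m ^ 12 \<le> card A" and upper: "card A \<le> 2 ^ 13 * m ^ 12"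
    and small: "int (card A * (2 * m ^ 5)) \<le> p"
  shows "(\<Sum>l\<in>A. (card (reps l))\<^sup>2) \<le> (card A)\<^sup>2 + 2 ^ 46 * m ^ 26"
proof -
  define n where "n = card A"
  note lower = lower[folded n_def] and upper = upper[folded n_def] and small = small[folded n_def]
  have mono: "m ^ i \<le> m ^ j" if "i \<le> j" for i j :: nat
    using m that by (simp add: power_increasing)
  have "int n \<le> p"
  proof -
    have "n * 1 \<le> n * (2 * m ^ 5)" using m by (intro mult_left_mono) (auto simp: Suc_le_eq)
    then show ?thesis using small by linarith
  qed
  then have Dp: "int (m ^ i) \<le> p" if "i \<le> 12" for i
    using mono[OF that] lower by linarith
  \<comment> \<open>Parameter count: 2 m^16 conditions against 4 m^16 unknowns.\<close>
  have M1: "card (sols c) \<le> 2 ^ 15 * m ^ 8" for c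
  proof -
    have "m ^ 8 * card (\<Union>c\<in>{c}. sols c) \<le> 2 * card A * (2 * m ^ 4)"
    proof (rule card_UN_sols_le[of _ _ "m ^ 8"])
      show "card {c} * (m ^ 8 * (m ^ 8 + m ^ 8)) < m ^ 8 * (2 * m ^ 4)\<^sup>2"
        using m by (simp add: power2_eq_square power_mult_distrib flip: power_add)
      show "m ^ 8 * (2 * m ^ 4) \<le> card A"
        using lower by (simp add: n_def mult.left_commute flip: power_add)
      have "n * (2 * m ^ 4) \<le> n * (2 * m ^ 5)" using mono[of 4 5] by simp
      then show "int (card A * (2 * m ^ 4)) \<le> p" using small unfolding n_def by linarith
    qed (auto intro: Dp simp del: of_nat_power)
    then have "m ^ 8 * card (sols c) \<le> n * (4 * m ^ 4)" by (simp add: n_def)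
    also have "\<dots> \<le> (2 ^ 13 * m ^ 12) * (4 * m ^ 4)" by (rule mult_right_mono[OF upper]) simp
    also have "\<dots> = m ^ 8 * (2 ^ 15 * m ^ 8)" by (simp add: mult_ac flip: power_add)
    finally show ?thesis using m by simp
  qed
  \<comment> \<open>Parameter count: at most 2 m^17 conditions against 4 m^17 unknowns.\<close>
  have M2: "card (\<Union>c\<in>C. sols c) \<le> 2 ^ 15 * m ^ 10" if C: "finite C" "card C \<le> m ^ 3" for C
  proof -
    have "m ^ 7 * card (\<Union>c\<in>C. sols c) \<le> 2 * card A * (2 * m ^ 5)"
    proof (rule card_UN_sols_le[OF C(1), of _ "m ^ 7"])
      have "card C * (m ^ 7 * (m ^ 7 + m ^ 7)) \<le> m ^ 3 * (m ^ 7 * (m ^ 7 + m ^ 7))"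
        by (rule mult_right_mono[OF C(2)]) simp
      also have "\<dots> < m ^ 7 * (2 * m ^ 5)\<^sup>2"
        using m by (simp add: power2_eq_square power_mult_distrib flip: power_add)
      finally show "card C * (m ^ 7 * (m ^ 7 + m ^ 7)) < m ^ 7 * (2 * m ^ 5)\<^sup>2" .
      show "m ^ 7 * (2 * m ^ 5) \<le> card A"
        using lower by (simp add: n_def mult.left_commute flip: power_add)
      show "int (card A * (2 * m ^ 5)) \<le> p" using small by (simp add: n_def)
    qed (auto intro: Dp simp del: of_nat_power)
    then have "m ^ 7 * card (\<Union>c\<in>C. sols c) \<le> n * (4 * m ^ 5)" by (simp add: n_def)
    also have "\<dots> \<le> (2 ^ 13 * m ^ 12) * (4 * m ^ 5)" by (rule mult_right_mono[OF upper]) simp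
    also have "\<dots> = m ^ 7 * (2 ^ 15 * m ^ 10)" by (simp add: mult_ac flip: power_add)
    finally show ?thesis using m by simp
  qed
  \<comment> \<open>The bound \<open>M2\<close> averaged over m^3 levels. As level sets are
    disjoint, m^3 levels with more than \<open>K\<close> points each would exceed
    \<open>M2\<close>.\<close>
  define K where "K = 2 ^ 15 * m ^ 7"
  define C where "C = {c \<in> {0..<p}. K < card (sols c)}"
  have finC: "finite C"
    by (rule finite_subset[of _ "{0..<p}"]) (auto simp: C_def)
  have "card C < m ^ 3"
  proof (rule ccontr)
    assume "\<not> card C < m ^ 3"
    then obtain C' where C': "C' \<subseteq> C" "card C' = m ^ 3" "finite C'"
      by (meson obtain_subset_with_card_n not_less)
    have "card (\<Union>c\<in>C'. sols c) = (\<Sum>c\<in>C'. card (sols c))"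
    proof (rule card_UN_disjoint[OF C'(3)])
      show "\<forall>i\<in>C'. \<forall>j\<in>C'. i \<noteq> j \<longrightarrow> sols i \<inter> sols j = {}"
      proof (intro ballI impI)
        fix i j assume ij: "i \<in> C'" "j \<in> C'" "i \<noteq> j"
        then have "i mod p = i" "j mod p = j" using C'(1) by (auto simp: C_def)
        then have "\<not> [i = j] (mod p)" using ij(3) by (simp add: Cong.cong_def)
        then show "sols i \<inter> sols j = {}" by (auto simp: sols_def dest: cong_sym cong_trans)
      qed
    qed (auto intro: finite_sols)
    moreover have "(\<Sum>c\<in>C'. Suc K) \<le> (\<Sum>c\<in>C'. card (sols c))"
      using C'(1) by (intro sum_mono) (auto simp: C_def Suc_le_eq)
    ultimately have "m ^ 3 * Suc K \<le> 2 ^ 15 * m ^ 10"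
      using M2[of C'] C' by simp
    moreover have "m ^ 3 * Suc K = m ^ 3 + 2 ^ 15 * m ^ 10"
      by (simp add: K_def mult.left_commute flip: power_add)
    ultimately show False using m by simp
  qed
  then have UC: "card (\<Union>c\<in>C. sols c) \<le> 2 ^ 15 * m ^ 10" using M2[OF finC] by simp
  have levelC: "card (reps l) \<le> K" if "l \<in> A - {1}" "level l \<notin> C" for l
  proof -
    have "level l \<in> {0..<p}" using prime_p by (simp add: level_def prime_gt_0_int)
    then have "card (sols (level l)) \<le> K" using that(2) by (simp add: C_def)
    then show ?thesis using card_reps_le[of l] that(1) by simp
  qed
  \<comment> \<open>The elements on rich levels: there are at most 2^15 m^10 of them, each with at
    most 2^15 m^8 representations. Every other l in \<open>A\<close> except 1 has at most
    \<open>K\<close> representations.\<close>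
  define B where "B = {l \<in> A - {1}. level l \<in> C}"
  have finB: "finite B" "finite (A - {1} - B)" using finite_A by (auto simp: B_def)
  have "(\<Sum>l\<in>B. (card (reps l))\<^sup>2) \<le> (\<Sum>l\<in>B. (2 ^ 15 * m ^ 8)\<^sup>2)"
    using card_reps_le M1 by (intro sum_mono power_mono) (auto simp: B_def intro: order_trans)
  also have "\<dots> = card B * (2 ^ 15 * m ^ 8)\<^sup>2" by simp
  also have "\<dots> \<le> (2 ^ 15 * m ^ 10) * (2 ^ 15 * m ^ 8)\<^sup>2"
    using card_level_in_le[OF finC] UC by (intro mult_right_mono) (auto simp: B_def)
  also have "\<dots> = 2 ^ 45 * m ^ 26"
    by (simp add: power_mult_distrib mult.left_commute flip: power_add power_mult)
  finally have 1: "(\<Sum>l\<in>B. (card (reps l))\<^sup>2) \<le> 2 ^ 45 * m ^ 26" .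
  have "(\<Sum>l\<in>A - {1} - B. (card (reps l))\<^sup>2) \<le> (\<Sum>l\<in>A - {1} - B. K\<^sup>2)"
    using levelC by (intro sum_mono power_mono) (auto simp: B_def)
  also have "\<dots> = card (A - {1} - B) * K\<^sup>2" by simp
  also have "\<dots> \<le> (2 ^ 13 * m ^ 12) * K\<^sup>2"
  proof (rule mult_right_mono)
    have "card (A - {1} - B) \<le> n" unfolding n_def using finite_A by (intro card_mono) auto
    with upper show "card (A - {1} - B) \<le> 2 ^ 13 * m ^ 12" by simp
  qed simp
  also have "\<dots> = 2 ^ 43 * m ^ 26"
    by (simp add: K_def power_mult_distrib mult.left_commute flip: power_add power_mult)
  finally have 2: "(\<Sum>l\<in>A - {1} - B. (card (reps l))\<^sup>2) \<le> 2 ^ 43 * m ^ 26" .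
  have "(\<Sum>l\<in>A. (card (reps l))\<^sup>2) = (card (reps 1))\<^sup>2 + (\<Sum>l\<in>A - {1}. (card (reps l))\<^sup>2)"
    using finite_A one_in by (rule sum.remove)
  also have "(\<Sum>l\<in>A - {1}. (card (reps l))\<^sup>2) = (\<Sum>l\<in>A - {1} - B. (card (reps l))\<^sup>2) + (\<Sum>l\<in>B. (card (reps l))\<^sup>2)"
    using finite_A by (intro sum.subset_diff) (auto simp: B_def)
  also have "(card (reps 1))\<^sup>2 \<le> (card A)\<^sup>2" using card_reps_1 by (intro power_mono) auto
  finally show ?thesis using 1 2 by simp
qed

text \<open>Cauchy-Schwarz gives n^8 <= X n^2 S with S the sum of the squared representation
  numbers, and S is O(n^(13/6)). The assumption \<open>small\<close> is 2 n^(17/12) <= p raised to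
  the power 12.\<close>

lemma card_heis_coords_ge:
  assumes n2: "2 \<le> card A" and small: "2 ^ 12 * real (card A) ^ 17 \<le> real_of_int p ^ 12"
  shows "real (card A) powr (23/6) \<le> 2 ^ 47 * real (card (heis_coords ` (A \<times> A \<times> A \<times> A)))"
proof -
  define n where "n = card A"
  define X where "X = card (heis_coords ` (A \<times> A \<times> A \<times> A))"
  have n0: "0 < real n" using n2 by (simp add: n_def)
  \<comment> \<open>The integer part of (n/2)^(1/12). It is positive as n >= 2, so k + 1 <= 2 k,
    which yields the upper bound with the factor 2^13.\<close>
  define k where "k = (LEAST k. n < 2 * Suc k ^ 12)"
  have "n < 2 * Suc n ^ 12"
    using self_le_power[of "Suc n" 12] by linarith
  then have k: "n < 2 * Suc k ^ 12" unfolding k_def by (rule LeastI)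
  have "k \<noteq> 0"
  proof
    assume "k = 0"
    with k n2 show False by (simp add: n_def)
  qed
  then have low: "2 * k ^ 12 \<le> n"
    using not_less_Least[of "k - 1" "\<lambda>k. n < 2 * Suc k ^ 12"] by (simp flip: k_def)
  have "Suc k ^ 12 \<le> (2 * k) ^ 12" using \<open>k \<noteq> 0\<close> by (intro power_mono) auto
  then have up: "n \<le> 2 ^ 13 * k ^ 12" using k by (simp add: power_mult_distrib)
  have kn: "real k ^ 12 \<le> real n"
  proof -
    have "k ^ 12 \<le> n" using low by simp
    then show ?thesis by (metis of_nat_le_iff of_nat_power)
  qed
  have "(real n * (2 * real k ^ 5)) ^ 12 = 2 ^ 12 * real n ^ 12 * (real k ^ 12) ^ 5"
    by (simp add: power_mult_distrib flip: power_mult)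
  also have "\<dots> \<le> 2 ^ 12 * real n ^ 12 * real n ^ 5"
    using kn by (intro mult_left_mono power_mono) auto
  also have "\<dots> = 2 ^ 12 * real n ^ 17" by (simp flip: power_add)
  also have "\<dots> \<le> real_of_int p ^ 12" using small by (simp add: n_def)
  finally have "real n * (2 * real k ^ 5) \<le> real_of_int p"
    using prime_gt_0_int[OF prime_p] by (subst (asm) power_mono_iff) auto
  then have "real_of_int (int (n * (2 * k ^ 5))) \<le> real_of_int p" by simp
  then have small': "int (n * (2 * k ^ 5)) \<le> p" by (simp only: of_int_le_iff)
  have S: "(\<Sum>l\<in>A. (card (reps l))\<^sup>2) \<le> n\<^sup>2 + 2 ^ 46 * k ^ 26"
    using sum_reps_squared_le[of k] \<open>k \<noteq> 0\<close> low up small' by (simp add: n_def)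
  have k26: "real k ^ 26 \<le> real n powr (13/6)"
  proof -
    have "real k ^ 26 = (real k ^ 12) powr (13/6)"
    proof -
      have "real k ^ 12 = real k powr 12" "real k ^ 26 = real k powr 26"
        using \<open>k \<noteq> 0\<close> by simp_all
      then show ?thesis by (simp only: powr_powr) simp
    qed
    also have "\<dots> \<le> real n powr (13/6)" using kn by (intro powr_mono2) auto
    finally show ?thesis .
  qed
  have n2p: "real n ^ 2 \<le> real n powr (13/6)"
    using n2 powr_mono[of 2 "13/6" "real n"] by (simp add: n_def)
  have S': "real (\<Sum>l\<in>A. (card (reps l))\<^sup>2) \<le> 2 ^ 47 * real n powr (13/6)"
  proof -
    have "real (\<Sum>l\<in>A. (card (reps l))\<^sup>2) \<le> real (n\<^sup>2 + 2 ^ 46 * k ^ 26)"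
      using S by (simp only: of_nat_le_iff)
    also have "\<dots> = real n ^ 2 + 2 ^ 46 * real k ^ 26" by simp
    also have "\<dots> \<le> real n powr (13/6) + 2 ^ 46 * real n powr (13/6)"
      using k26 n2p by (intro add_mono mult_left_mono) auto
    also have "\<dots> \<le> 2 ^ 47 * real n powr (13/6)" by simp
    finally show ?thesis .
  qed
  have "(n ^ 4)\<^sup>2 \<le> X * (n\<^sup>2 * (\<Sum>l\<in>A. (card (reps l))\<^sup>2))"
  proof -
    have "card (A \<times> A \<times> A \<times> A) = n ^ 4"
      by (simp add: n_def card_cartesian_product power_def numeral_eq_Suc)
    then have "(n ^ 4)\<^sup>2 \<le> X * card {(s, t). s \<in> A \<times> A \<times> A \<times> A \<and> t \<in> A \<times> A \<times> A \<times> A \<and> heis_coords s = heis_coords t}"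
      using card_squared_le_card_image_times_collisions[of "A \<times> A \<times> A \<times> A" heis_coords] finite_A
      by (simp add: X_def)
    also have "\<dots> \<le> X * (n\<^sup>2 * (\<Sum>l\<in>A. (card (reps l))\<^sup>2))"
      using card_collisions_le unfolding n_def by (rule mult_left_mono) simp
    finally show ?thesis .
  qed
  then have "real ((n ^ 4)\<^sup>2) \<le> real (X * (n\<^sup>2 * (\<Sum>l\<in>A. (card (reps l))\<^sup>2)))"
    by (simp only: of_nat_le_iff)
  then have "real n ^ 8 \<le> real X * (real n ^ 2 * real (\<Sum>l\<in>A. (card (reps l))\<^sup>2))"
    by (simp flip: power_mult)
  also have "\<dots> \<le> real X * (real n ^ 2 * (2 ^ 47 * real n powr (13/6)))"
    using S' by (intro mult_left_mono) auto
  finally have "real n powr 8 \<le> (2 ^ 47 * real X) * (real n powr 2 * real n powr (13/6))"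
    using n0 by (simp add: powr_numeral mult_ac)
  also have "real n powr 8 = real n powr (23/6) * (real n powr 2 * real n powr (13/6))"
    unfolding powr_add[symmetric] by simp
  finally show ?thesis using n0 by (simp add: n_def X_def)
qed

end

section \<open>Passage from coordinates to matrices\<close>

lemma heis_inject: "heis R x y z = heis R x' y' z' \<longleftrightarrow> x = x' \<and> y = y' \<and> z = z'"
proof
  assume h: "heis R x y z = heis R x' y' z'"
  then have "heis R x y z $ 1 $ 2 = heis R x' y' z' $ 1 $ 2" "heis R x y z $ 2 $ 3 = heis R x' y' z' $ 2 $ 3"
    "heis R x y z $ 1 $ 3 = heis R x' y' z' $ 1 $ 3" by simp_all
  then show "x = x' \<and> y = y' \<and> z = z'" by (simp add: heis_def)
qed simp

lemma card_heis_box: "card (heis_box R A) = (card A)\<^sup>2"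
proof -
  have "heis_box R A = (\<lambda>(x, y). heis R x y \<zero>\<^bsub>R\<^esub>) ` (A \<times> A)" by (auto simp: heis_box_def)
  moreover have "inj_on (\<lambda>(x, y). heis R x y \<zero>\<^bsub>R\<^esub>) (A \<times> A)" by (auto simp: inj_on_def heis_inject)
  ultimately show ?thesis by (simp add: card_image card_cartesian_product power2_eq_square)
qed

lemma subgroup_mod_residue_ring:
  assumes "prime p" and A: "subgroup A (units_of (residue_ring (int p)))"
  shows "subgroup_mod (int p) A"
proof -
  define R where "R = residue_ring (int p)"
  interpret residues_prime p R using assms(1) unfolding R_def by unfold_locales simp_all
  interpret U: group "units_of R" by (rule units_group)
  have A: "subgroup A (units_of R)" using A by (simp add: R_def)
  have mult: "x \<otimes>\<^bsub>units_of R\<^esub> y = x * y mod int p" for x y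
    by (simp add: units_of_mult res_mult_eq)
  have one: "\<one>\<^bsub>units_of R\<^esub> = 1" by (simp add: units_of_one res_one_eq)
  show ?thesis
  proof
    show "prime (int p)" using assms(1) by simp
    show "A \<subseteq> {1..<int p}"
    proof
      fix x assume "x \<in> A"
      then have "x \<in> {1..int p - 1}"
        using subgroup.subset[OF A] res_prime_units_eq prime_gt_0_nat[OF assms(1)]
        by (auto simp: units_of_carrier of_nat_diff)
      then show "x \<in> {1..<int p}" by simp
    qed
    show "1 \<in> A" using subgroup.one_closed[OF A] one by simp
    show "x * y mod int p \<in> A" if "x \<in> A" "y \<in> A" for x y
      using subgroup.m_closed[OF A that] mult by simp
    show "\<exists>y\<in>A. [x * y = 1] (mod int p)" if "x \<in> A" for x
    proof
      show "inv\<^bsub>units_of R\<^esub> x \<in> A" using subgroup.m_inv_closed[OF A that] .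
      have "x \<otimes>\<^bsub>units_of R\<^esub> inv\<^bsub>units_of R\<^esub> x = \<one>\<^bsub>units_of R\<^esub>"
        using subgroup.mem_carrier[OF A that] by (rule U.r_inv)
      then have "x * inv\<^bsub>units_of R\<^esub> x mod int p = 1" unfolding mult one .
      then show "[x * inv\<^bsub>units_of R\<^esub> x = 1] (mod int p)"
        using assms(1) prime_gt_1_nat[of p] by (simp add: Cong.cong_def)
    qed
  qed
qed

text \<open>A matrix determines its three coordinates, so counting products amounts to counting
  coordinate triples.\<close>

lemma card_heis_box_square:
  assumes "prime p" and A: "subgroup A (units_of (residue_ring (int p)))"
  shows "card (heis_box (residue_ring (int p)) A <#>\<^bsub>heisenberg_group (residue_ring (int p))\<^esub> heis_box (residue_ring (int p)) A)
    = card (subgroup_mod.heis_coords (int p) ` (A \<times> A \<times> A \<times> A))"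
proof -
  define R where "R = residue_ring (int p)"
  interpret residues_prime p R using assms(1) unfolding R_def by unfold_locales simp_all
  interpret subgroup_mod "int p" A using assms by (rule subgroup_mod_residue_ring)
  have AR: "x \<in> carrier R" if "x \<in> A" for x
    using that A_subset by (auto simp: res_carrier_eq)
  have zero_R: "0 \<in> carrier R" using zero_closed by (simp only: res_zero_eq)
  have mult: "mat3_mult R (heis R x y \<zero>\<^bsub>R\<^esub>) (heis R x' y' \<zero>\<^bsub>R\<^esub>)
     = (\<lambda>(x, y, z). heis R x y z) (heis_coords (x, x', y, y'))"
    if "x \<in> A" "y \<in> A" "x' \<in> A" "y' \<in> A" for x y x' y'
    using that AR cring zero_R by (subst mat3_mult_heis)
      (auto simp: heis_coords_def res_add_eq res_mult_eq res_zero_eq mod_simps)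
  have "heis_box R A <#>\<^bsub>heisenberg_group R\<^esub> heis_box R A
     = (\<lambda>(x, y, z). heis R x y z) ` (heis_coords ` (A \<times> A \<times> A \<times> A))"
  proof -
    have "heis_box R A <#>\<^bsub>heisenberg_group R\<^esub> heis_box R A
      = {mat3_mult R (heis R x y \<zero>\<^bsub>R\<^esub>) (heis R x' y' \<zero>\<^bsub>R\<^esub>) | x y x' y'. x \<in> A \<and> y \<in> A \<and> x' \<in> A \<and> y' \<in> A}"
      by (auto simp: set_mult_def heis_box_def heisenberg_group_def)
    also have "\<dots> = (\<lambda>(x, y, z). heis R x y z) ` (heis_coords ` (A \<times> A \<times> A \<times> A))"
    proof (intro equalityI subsetI)
      fix g assume "g \<in> {mat3_mult R (heis R x y \<zero>\<^bsub>R\<^esub>) (heis R x' y' \<zero>\<^bsub>R\<^esub>) | x y x' y'. x \<in> A \<and> y \<in> A \<and> x' \<in> A \<and> y' \<in> A}"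
      then obtain x y x' y' where "g = mat3_mult R (heis R x y \<zero>\<^bsub>R\<^esub>) (heis R x' y' \<zero>\<^bsub>R\<^esub>)" "x \<in> A" "y \<in> A" "x' \<in> A" "y' \<in> A"
        by blast
      then show "g \<in> (\<lambda>(x, y, z). heis R x y z) ` (heis_coords ` (A \<times> A \<times> A \<times> A))"
        using mult by (intro image_eqI[of _ _ "heis_coords (x, x', y, y')"]) auto
    next
      fix g assume "g \<in> (\<lambda>(x, y, z). heis R x y z) ` (heis_coords ` (A \<times> A \<times> A \<times> A))"
      then obtain x y x' y' where g: "g = (\<lambda>(x, y, z). heis R x y z) (heis_coords (x, x', y, y'))" "x \<in> A" "y \<in> A" "x' \<in> A" "y' \<in> A"
        by blast
      then have "g = mat3_mult R (heis R x y \<zero>\<^bsub>R\<^esub>) (heis R x' y' \<zero>\<^bsub>R\<^esub>)" using mult by simp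
      with g show "g \<in> {mat3_mult R (heis R x y \<zero>\<^bsub>R\<^esub>) (heis R x' y' \<zero>\<^bsub>R\<^esub>) | x y x' y'. x \<in> A \<and> y \<in> A \<and> x' \<in> A \<and> y' \<in> A}"
        by blast
    qed
    finally show ?thesis .
  qed
  moreover have "inj_on (\<lambda>(x, y, z). heis R x y z) S" for S
    by (auto simp: inj_on_def heis_inject)
  ultimately show ?thesis by (simp add: card_image R_def)
qed

theorem theorem1p8:
  "\<exists>C>0. \<exists>C'>0. \<forall>(p::nat) (A::int set).
     prime p \<longrightarrow>
     subgroup A (units_of (residue_ring (int p))) \<longrightarrow>
     real (card A) \<le> real p powr (1/2) * ln (real p) \<longrightarrow>
     (let R = residue_ring (int p); B = heis_box R A in
        gtrsim C C' (real (card (B <#>\<^bsub>heisenberg_group R\<^esub> B)))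
                    (real (card B) powr (151/80)))"
proof -
  \<comment> \<open>The left side is p^(17/2) up to logarithms, so for large \<open>p\<close> the
    size condition of Stepanov's method holds.\<close>
  have "eventually (\<lambda>p::nat. 2 ^ 12 * (real p powr (1/2) * ln (real p)) ^ 17 \<le> real p ^ 12) at_top"
    by real_asymp
  then obtain P where P: "\<And>p. P \<le> p \<Longrightarrow> 2 ^ 12 * (real p powr (1/2) * ln (real p)) ^ 17 \<le> real p ^ 12"
    by (auto simp: eventually_at_top_linorder)
  \<comment> \<open>The first summand serves large \<open>p\<close> with n >= 2, the second the
    remaining cases.\<close>
  define C where "C = 2 ^ 47 + (real P + 1) ^ 4"
  have main: "real (card B) powr (151/80) \<le> C * real Y"
    if "prime p" and A: "subgroup A (units_of (residue_ring (int p)))"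
      and small: "real (card A) \<le> real p powr (1/2) * ln (real p)"
      and B: "B = heis_box (residue_ring (int p)) A"
      and Y: "Y = card (B <#>\<^bsub>heisenberg_group (residue_ring (int p))\<^esub> B)"
    for p A B Y
  proof -
    interpret subgroup_mod "int p" A using that(1,2) by (rule subgroup_mod_residue_ring)
    have Y': "Y = card (heis_coords ` (A \<times> A \<times> A \<times> A))"
      unfolding Y B by (rule card_heis_box_square[OF that(1,2)])
    have "heis_coords ` (A \<times> A \<times> A \<times> A) \<noteq> {}" using one_in by auto
    then have Y1: "1 \<le> real Y" using finite_A by (simp add: Y' card_gt_0_iff Suc_le_eq)
    define n where "n = card A"
    have n1: "1 \<le> real n" using card_A_pos by (simp add: n_def)
    have B': "real (card B) powr (151/80) = real n powr (151/40)"
    proof -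
      have "real (card B) = real n powr 2" using n1 by (simp add: B card_heis_box n_def)
      then show ?thesis by (simp only: powr_powr) simp
    qed
    show ?thesis
    proof (cases "P \<le> p \<and> 2 \<le> n")
      case True
      have "2 ^ 12 * real n ^ 17 \<le> 2 ^ 12 * (real p powr (1/2) * ln (real p)) ^ 17"
        using small by (intro mult_left_mono power_mono) (auto simp: n_def)
      also have "\<dots> \<le> real_of_int (int p) ^ 12" using P True by simp
      finally have "real n powr (23/6) \<le> 2 ^ 47 * real Y"
        unfolding Y' n_def using True by (intro card_heis_coords_ge) (auto simp: n_def)
      moreover have "real n powr (151/40) \<le> real n powr (23/6)" using n1 by (intro powr_mono) auto
      moreover have "2 ^ 47 * real Y \<le> C * real Y" by (intro mult_right_mono) (auto simp: C_def)
      ultimately show ?thesis unfolding B' by linarith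
    next
      \<comment> \<open>Either n < p < P or n < 2, so n <= P + 1; the left side is at most n^4, and
        the product set is nonempty.\<close>
      case False
      have "card A \<le> card {1..<int p}" using A_subset by (intro card_mono) auto
      then have "real n \<le> real P + 1" using False by (auto simp: n_def)
      have "real n powr (151/40) \<le> real n powr 4" using n1 by (intro powr_mono) auto
      also have "\<dots> = real n ^ 4" using n1 by (simp add: powr_numeral)
      also have "\<dots> \<le> (real P + 1) ^ 4" using \<open>real n \<le> real P + 1\<close> by (intro power_mono) auto
      also have "\<dots> \<le> C * 1" by (simp add: C_def)
      also have "\<dots> \<le> C * real Y" using Y1 by (intro mult_left_mono) (auto simp: C_def)
      finally show ?thesis unfolding B' .
    qed
  qed
  have C0: "0 < C" unfolding C_def by (intro add_pos_nonneg) auto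
  \<comment> \<open>The logarithmic factor is at least 1, so a bound without logarithms
    suffices.\<close>
  have "gtrsim C 1 (real Y) X" if "X \<le> C * real Y" for X Y
  proof -
    have "C * (1 * real Y) \<le> C * (max 1 (ln (real Y)) powr 1 * real Y)"
      using C0 by (intro mult_left_mono mult_right_mono) auto
    with that show ?thesis by (simp add: lesssim_def)
  qed
  with main C0 show ?thesis
    unfolding Let_def by (intro exI[of _ C] conjI exI[of _ 1] allI impI) auto
qed

end
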